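(* Suppose $E:\mathcal{P}_{2,\omega_0}(\mathbb{R}^d)\to\mathbb{R}\cup\{+\infty\}$ is proper, coercive, lower semicontinuous and $\lambda$-convex along generalized geodesics for some $\lambda\in\mathbb{R}$. Let $\mu\in D(|\partial E|)$ and let $h_1,h_2,\dots$ and $\tau$ satisfy $0<h_i\le\tau<\frac1{\lambda^-}$. Write $J^m=J_{h_m}\circ\cdots\circ J_{h_1}\mu$ (with $J^0=\mu$), $J^n=J^n_\tau\mu$, and $P_m=\prod_{k=1}^m(1-\lambda^-h_k)^{-1}$. Then for $n,m\ge1$, $$(1-\lambda^-h_m)^2W_2^2(J^n,J^m)\le\frac{h_m}{\tau}(1-\lambda^-\tau)^{-1}W_2^2(J^{n-1},J^{m-1})+\frac{\tau-h_m}{\tau}W_2^2(J^{m-1},J^n)+2h_m^2P_m^2|\partial E|^2(\mu).$$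
   Context: Fix a probability measure $\omega_0$ on $\mathbb{R}^d$. $W_2$ is the quadratic Wasserstein distance, $\Gamma_0$ the optimal couplings; $\mathcal{P}_{2,\omega_0}(\mathbb{R}^d)=\{\mu:W_2(\mu,\omega_0)<\infty\}$. A transport plan from $\mu_0$ to $\mu_1$ with base $\omega$ is $\boldsymbol\omega\in\mathcal{P}((\mathbb{R}^d)^3)$ with $\pi^{1,2}\#\boldsymbol\omega\in\Gamma_0(\omega,\mu_0)$, $\pi^{1,3}\#\boldsymbol\omega\in\Gamma_0(\omega,\mu_1)$; generalized geodesic $\mu_\alpha=((1-\alpha)\pi^2+\alpha\pi^3)\#\boldsymbol\omega$; $W_{2,\boldsymbol\omega}(\mu_0,\mu_1)=(\int|x_2-x_3|^2d\boldsymbol\omega)^{1/2}$. $D(E)=\{E<\infty\}$; proper: $D(E)\ne\emptyset$; coercive: $\exists\tau_0>0,u_0$ with $\inf_v\{\frac1{2\tau_0}W_2^2(u_0,v)+E(v)\}>-\infty$; lower semicontinuous w.r.t. $W_2$; $\lambda$-convex along generalized geodesics: for all $\mu_0,\mu_1,\omega$ there is a generalized geodesic from $\mu_0$ to $\mu_1$ with base $\omega$ (induced by some $\boldsymbol\omega$) with $E(\mu_\alpha)\le(1-\alpha)E(\mu_0)+\alpha E(\mu_1)-\alpha(1-\alpha)\frac\lambda2W^2_{2,\boldsymbol\omega}(\mu_0,\mu_1)$. $\lambda^-=\max\{0,-\lambda\}$, $1/\lambda^-=+\infty$ if $\lambda^-=0$. $J_\tau\mu=\operatorname{argmin}_\nu\{\frac1{2\tau}W_2^2(\mu,\nu)+E(\nu)\}$,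 $J^n_\tau$ its $n$-fold iterate. Metric slope $|\partial E|(\mu)=\limsup_{\nu\to\mu}(E(\mu)-E(\nu))^+/W_2(\mu,\nu)$; $D(|\partial E|)=\{\mu\in D(E):|\partial E|(\mu)<\infty\}$. *)

theory Defs
  imports "HOL-Probability.Probability"
begin

definition prob_borel :: "'a::euclidean_space measure \<Rightarrow> bool" where
  "prob_borel \<mu> \<longleftrightarrow> prob_space \<mu> \<and> sets \<mu> = sets borel"

definition couplings :: "'a::euclidean_space measure \<Rightarrow> 'a measure \<Rightarrow> ('a \<times> 'a) measure set" where
  "couplings \<mu> \<nu> = {\<gamma>. prob_space \<gamma> \<and> sets \<gamma> = sets (borel \<Otimes>\<^sub>M borel)
      \<and> distr \<gamma> borel fst = \<mu> \<and> distr \<gamma> borel snd = \<nu>}"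

definition cost2 :: "('a::euclidean_space \<times> 'a) measure \<Rightarrow> ennreal" where
  "cost2 \<gamma> = (\<integral>\<^sup>+ p. ennreal ((norm (fst p - snd p))\<^sup>2) \<partial>\<gamma>)"

definition W2sq :: "'a::euclidean_space measure \<Rightarrow> 'a measure \<Rightarrow> ennreal" where
  "W2sq \<mu> \<nu> = (INF \<gamma>\<in>couplings \<mu> \<nu>. cost2 \<gamma>)"

text \<open>Wasserstein distance as a real number (used only when it is finite).\<close>
definition W2 :: "'a::euclidean_space measure \<Rightarrow> 'a measure \<Rightarrow> real" where
  "W2 \<mu> \<nu> = sqrt (enn2real (W2sq \<mu> \<nu>))"

definition opt_couplings :: "'a::euclidean_space measure \<Rightarrow> 'a measure \<Rightarrow> ('a \<times> 'a) measure set" where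
  "opt_couplings \<mu> \<nu> = {\<gamma>\<in>couplings \<mu> \<nu>. cost2 \<gamma> = W2sq \<mu> \<nu>}"

definition P2 :: "'a::euclidean_space measure \<Rightarrow> 'a measure set" where
  "P2 \<omega>0 = {\<mu>. prob_borel \<mu> \<and> W2sq \<mu> \<omega>0 < \<infinity>}"

definition transport_plans ::
  "'a::euclidean_space measure \<Rightarrow> 'a measure \<Rightarrow> 'a measure \<Rightarrow> ('a \<times> 'a \<times> 'a) measure set" where
  "transport_plans \<omega> \<mu>0 \<mu>1 = {w. prob_space w \<and> sets w = sets (borel \<Otimes>\<^sub>M (borel \<Otimes>\<^sub>M borel))
      \<and> distr w (borel \<Otimes>\<^sub>M borel) (\<lambda>(x1, x2, x3). (x1, x2)) \<in> opt_couplings \<omega> \<mu>0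
      \<and> distr w (borel \<Otimes>\<^sub>M borel) (\<lambda>(x1, x2, x3). (x1, x3)) \<in> opt_couplings \<omega> \<mu>1}"

definition gen_geod :: "('a::euclidean_space \<times> 'a \<times> 'a) measure \<Rightarrow> real \<Rightarrow> 'a measure" where
  "gen_geod w \<alpha> = distr w borel (\<lambda>(x1, x2, x3). (1 - \<alpha>) *\<^sub>R x2 + \<alpha> *\<^sub>R x3)"

definition W2plan_sq :: "('a::euclidean_space \<times> 'a \<times> 'a) measure \<Rightarrow> real" where
  "W2plan_sq w = enn2real (\<integral>\<^sup>+ p. ennreal ((norm (fst (snd p) - snd (snd p)))\<^sup>2) \<partial>w)"

definition energy_on :: "'a::euclidean_space measure \<Rightarrow> ('a measure \<Rightarrow> ereal) \<Rightarrow> bool" where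
  "energy_on \<omega>0 E \<longleftrightarrow> (\<forall>\<mu>\<in>P2 \<omega>0. E \<mu> \<noteq> -\<infinity>)"

definition proper_E :: "'a::euclidean_space measure \<Rightarrow> ('a measure \<Rightarrow> ereal) \<Rightarrow> bool" where
  "proper_E \<omega>0 E \<longleftrightarrow> (\<exists>\<mu>\<in>P2 \<omega>0. E \<mu> < \<infinity>)"

definition coercive_E :: "'a::euclidean_space measure \<Rightarrow> ('a measure \<Rightarrow> ereal) \<Rightarrow> bool" where
  "coercive_E \<omega>0 E \<longleftrightarrow> (\<exists>\<tau>0>0. \<exists>u0\<in>P2 \<omega>0.
      (INF v\<in>P2 \<omega>0. ereal ((W2 u0 v)\<^sup>2 / (2 * \<tau>0)) + E v) > -\<infinity>)"

text \<open>Lower semicontinuity w.r.t. W_2 (sequential, equivalent in the metric space P_{2,omega0}).\<close>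
definition lsc_E :: "'a::euclidean_space measure \<Rightarrow> ('a measure \<Rightarrow> ereal) \<Rightarrow> bool" where
  "lsc_E \<omega>0 E \<longleftrightarrow> (\<forall>\<mu> \<mu>s. \<mu> \<in> P2 \<omega>0 \<longrightarrow> (\<forall>n. \<mu>s n \<in> P2 \<omega>0) \<longrightarrow>
      (\<lambda>n. W2 (\<mu>s n) \<mu>) \<longlonglongrightarrow> 0 \<longrightarrow> E \<mu> \<le> liminf (\<lambda>n. E (\<mu>s n)))"

definition gg_convex :: "'a::euclidean_space measure \<Rightarrow> ('a measure \<Rightarrow> ereal) \<Rightarrow> real \<Rightarrow> bool" where
  "gg_convex \<omega>0 E lam \<longleftrightarrow> (\<forall>\<mu>0\<in>P2 \<omega>0. \<forall>\<mu>1\<in>P2 \<omega>0. \<forall>\<omega>\<in>P2 \<omega>0.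
      \<exists>w\<in>transport_plans \<omega> \<mu>0 \<mu>1. \<forall>\<alpha>\<in>{0..1}.
        E (gen_geod w \<alpha>) \<le> ereal (1 - \<alpha>) * E \<mu>0 + ereal \<alpha> * E \<mu>1
           - ereal (\<alpha> * (1 - \<alpha>) * (lam / 2) * W2plan_sq w))"

definition prox :: "'a::euclidean_space measure \<Rightarrow> ('a measure \<Rightarrow> ereal) \<Rightarrow> real \<Rightarrow> 'a measure \<Rightarrow> 'a measure" where
  "prox \<omega>0 E \<tau> \<mu> = (SOME \<nu>. \<nu> \<in> P2 \<omega>0 \<and>
      (\<forall>\<rho>\<in>P2 \<omega>0. ereal ((W2 \<mu> \<nu>)\<^sup>2 / (2 * \<tau>)) + E \<nu> \<le> ereal ((W2 \<mu> \<rho>)\<^sup>2 / (2 * \<tau>)) + E \<rho>))"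

text \<open>Iterates J_{h_m} o ... o J_{h_1} mu with variable steps (h indexed from 1).\<close>
primrec prox_iter :: "'a::euclidean_space measure \<Rightarrow> ('a measure \<Rightarrow> ereal) \<Rightarrow> (nat \<Rightarrow> real) \<Rightarrow> 'a measure \<Rightarrow> nat \<Rightarrow> 'a measure" where
  "prox_iter \<omega>0 E h \<mu> 0 = \<mu>"
| "prox_iter \<omega>0 E h \<mu> (Suc m) = prox \<omega>0 E (h (Suc m)) (prox_iter \<omega>0 E h \<mu> m)"

text \<open>Metric slope: limsup over nu -> mu (nu \<noteq> mu) of (E mu - E nu)^+ / W2(mu,nu).\<close>
definition slope :: "'a::euclidean_space measure \<Rightarrow> ('a measure \<Rightarrow> ereal) \<Rightarrow> 'a measure \<Rightarrow> ereal" where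
  "slope \<omega>0 E \<mu> = (INF r\<in>{0<..}. SUP \<nu>\<in>{\<nu>\<in>P2 \<omega>0. 0 < W2 \<mu> \<nu> \<and> W2 \<mu> \<nu> < r}.
      max 0 (E \<mu> - E \<nu>) / ereal (W2 \<mu> \<nu>))"

end

theory Submission
  imports Defs
begin

text \<open>
  Write \<open>k = \<lambda>\<^sup>-\<close>, and call \<open>s\<close> a slope bound at \<open>y\<close> if
  \<open>E y \<le> E v + s W(y,v) + k/2 W(y,v)\<^sup>2\<close> for all \<open>v\<close>. Convexity along geodesics turns the metric slope
  of \<open>\<mu>\<close> into a slope bound at \<open>\<mu>\<close>. Convexity along generalized geodesics based at \<open>y\<close> makes
  \<open>v \<mapsto> W(y,v)\<^sup>2/2h + E v\<close> uniformly convex, so if \<open>y\<close> has a slope bound, minimizing sequences are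
  Cauchy and, as the space is complete, \<open>Y = J\<^sub>h y\<close> exists. It satisfies the discrete variational inequality
  \<open>(1 - k h) W(Y,v)\<^sup>2 + W(y,Y)\<^sup>2 \<le> W(y,v)\<^sup>2 + 2 h (E v - E Y)\<close>,
  from which \<open>Y\<close> inherits the slope bound \<open>s / (1 - k h)\<close>.

  For \<open>X = J\<^sub>\<tau> x\<close> and \<open>Y = J\<^sub>h y\<close>, the claim is the sum of \<open>1 - k h\<close> times the inequality for \<open>Y\<close>
  tested at \<open>X\<close> and \<open>h/\<tau>\<close> times the inequality for \<open>X\<close> tested at \<open>y\<close>; the remaining energy differences
  \<open>E y - E Y\<close> and \<open>E y - E X\<close> are controlled by the slope bound at \<open>y\<close>.

  The triangle inequality and completeness of the Wasserstein space rest on gluing couplings.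
  Disintegration of measures is avoided: couplings are glued only up to an error \<open>\<epsilon>\<close> in the
  intermediate point, by conditioning on the cells of a countable partition of mesh \<open>\<epsilon>\<close>.
\<close>

section \<open>Approximate gluing of couplings\<close>

text \<open>\<open>K x\<close> is \<open>N\<close> conditioned on the event that \<open>g\<close>
  takes the value \<open>f x\<close>. Since \<open>f\<close> and \<open>g\<close> have the same law,
  averaging these conditional laws over \<open>M\<close> is the formula of total probability for
  \<open>N\<close>.\<close>

lemma matching_kernel:
  fixes f :: "'b \<Rightarrow> nat" and g :: "'c \<Rightarrow> nat"
  assumes "prob_space M" "prob_space N"
    and f[measurable]: "f \<in> measurable M (count_space UNIV)"
    and g[measurable]: "g \<in> measurable N (count_space UNIV)"
    and eq: "distr M (count_space UNIV) f = distr N (count_space UNIV) g"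
  obtains K where "K \<in> measurable M (subprob_algebra N)" "\<And>x. prob_space (K x)"
    "M \<bind> K = N" "AE x in M. AE y in K x. g y = f x"
proof -
  interpret M: prob_space M by fact
  interpret N: prob_space N by fact
  let ?G = "\<lambda>j. {y\<in>space N. g y = j}"
  \<comment> \<open>On a null cell conditioning is undefined; the default \<open>N\<close> keeps
    every \<open>k j\<close> a probability measure. Such cells are met with probability
    zero.\<close>
  define k where "k j = (if emeasure N (?G j) = 0 then N else uniform_measure N (?G j))" for j
  have sets_k[measurable_cong, simp]: "sets (k j) = sets N" for j
    by (simp add: k_def)
  have prob_k: "prob_space (k j)" for j
    unfolding k_def using N.prob_space_axioms
    by (auto intro!: prob_space_uniform_measure)
  have k_space: "k j \<in> space (subprob_algebra N)" for j
    using prob_k[of j] by (simp add: space_subprob_algebra prob_space_imp_subprob_space)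
  have k_meas[measurable]: "k \<in> measurable (count_space UNIV) (subprob_algebra N)"
    using k_space by simp
  define K where "K x = k (f x)" for x
  have K: "K \<in> measurable M (subprob_algebra N)"
    unfolding K_def by measurable
  have bind: "M \<bind> K = N"
  proof (rule measure_eqI)
    show "sets (M \<bind> K) = sets N"
      by (rule sets_bind) (auto simp: K_def M.not_empty)
    fix A assume "A \<in> sets (M \<bind> K)"
    then have A[measurable]: "A \<in> sets N" using \<open>sets (M \<bind> K) = sets N\<close> by simp
    have "emeasure (M \<bind> K) A = (\<integral>\<^sup>+x. emeasure (k (f x)) A \<partial>M)"
      using K by (subst emeasure_bind[OF M.not_empty _ A]) (auto simp: K_def)
    also have "\<dots> = (\<integral>\<^sup>+j. emeasure (k j) A \<partial>distr M (count_space UNIV) f)"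
      by (subst nn_integral_distr) auto
    also have "\<dots> = (\<integral>\<^sup>+y. emeasure (k (g y)) A \<partial>N)"
      unfolding eq by (subst nn_integral_distr) auto
    also have "\<dots> = (\<integral>\<^sup>+y. (\<Sum>j. emeasure (k j) A * indicator (?G j) y) \<partial>N)"
    proof (rule nn_integral_cong)
      fix y assume "y \<in> space N"
      then have "(\<Sum>j. emeasure (k j) A * indicator (?G j) y)
          = (\<Sum>j. if j = g y then emeasure (k j) A else 0)"
        by (intro suminf_cong) (auto simp: indicator_def)
      also have "\<dots> = emeasure (k (g y)) A"
        using sums_single[of "g y" "\<lambda>j. emeasure (k j) A"] by (simp add: sums_iff eq_commute)
      finally show "emeasure (k (g y)) A = (\<Sum>j. emeasure (k j) A * indicator (?G j) y)" ..
    qed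
    also have "\<dots> = (\<Sum>j. \<integral>\<^sup>+y. emeasure (k j) A * indicator (?G j) y \<partial>N)"
      by (rule nn_integral_suminf) auto
    also have "\<dots> = (\<Sum>j. emeasure (k j) A * emeasure N (?G j))"
      by (intro suminf_cong nn_integral_cmult_indicator) auto
    also have "\<dots> = (\<Sum>j. emeasure N (?G j \<inter> A))"
    proof (intro suminf_cong)
      fix j
      show "emeasure (k j) A * emeasure N (?G j) = emeasure N (?G j \<inter> A)"
      proof (cases "emeasure N (?G j) = 0")
        case True
        have "emeasure N (?G j \<inter> A) \<le> emeasure N (?G j)"
          by (rule emeasure_mono) auto
        with True show ?thesis by simp
      next
        case False
        have "emeasure N (?G j \<inter> A) / emeasure N (?G j) * emeasure N (?G j) = emeasure N (?G j \<inter> A)"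
          using False by (intro ennreal_divide_times[THEN trans] )
            (simp add: ennreal_times_divide[symmetric] ennreal_mult_divide_eq N.emeasure_eq_measure)
        then show ?thesis using False by (simp add: k_def)
      qed
    qed
    also have "\<dots> = emeasure N (\<Union>j. ?G j \<inter> A)"
      by (rule suminf_emeasure) (auto simp: disjoint_family_on_def)
    also have "(\<Union>j. ?G j \<inter> A) = A"
      using sets.sets_into_space[OF A] by auto
    finally show "emeasure (M \<bind> K) A = emeasure N A" .
  qed
  \<comment> \<open>The null cells are countably many, so \<open>g\<close> almost surely avoids them
    all; the equality of laws carries this over to \<open>f\<close>.\<close>
  have "AE x in M. emeasure N (?G (f x)) \<noteq> 0"
  proof -
    have "AE y in N. emeasure N (?G (g y)) \<noteq> 0"
    proof -
      have "AE y in N. \<forall>j. emeasure N (?G j) = 0 \<longrightarrow> g y \<noteq> j"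
      proof (subst AE_all_countable, intro allI)
        fix j
        show "AE y in N. emeasure N (?G j) = 0 \<longrightarrow> g y \<noteq> j"
          by (cases "emeasure N (?G j) = 0") (auto intro!: AE_I[of _ _ "?G j"])
      qed
      then show ?thesis by eventually_elim auto
    qed
    then have "AE j in distr N (count_space UNIV) g. emeasure N (?G j) \<noteq> 0"
      by (subst AE_distr_iff) auto
    then show ?thesis
      unfolding eq[symmetric] by (subst (asm) AE_distr_iff) auto
  qed
  then have "AE x in M. AE y in K x. g y = f x"
  proof eventually_elim
    case (elim x)
    then have "K x = uniform_measure N (?G (f x))" by (simp add: K_def k_def)
    then show ?case by (simp only:) (rule AE_uniform_measureI, auto)
  qed
  with K bind prob_k show ?thesis by (intro that[of K]) (auto simp: K_def)
qed

text \<open>The Ionescu-Tulcea theorem with kernels that look only at the last coordinate.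
  \<open>step\<close> propagates the marginals by induction, and \<open>AE_R\<close> concerns two
  neighbouring coordinates, so it can be checked on finite initial segments.\<close>

lemma markov_chain_exists:
  fixes \<Gamma> :: "nat \<Rightarrow> 'b measure" and K :: "nat \<Rightarrow> 'b \<Rightarrow> 'b measure"
  assumes prob: "\<And>n. prob_space (\<Gamma> n)" and sets_\<Gamma>: "\<And>n. sets (\<Gamma> n) = sets S"
    and K[measurable]: "\<And>n. K n \<in> measurable S (subprob_algebra S)"
    and prob_K: "\<And>n x. prob_space (K n x)"
    and step: "\<And>n. \<Gamma> n \<bind> K n = \<Gamma> (Suc n)"
    and R[measurable]: "\<And>n. Measurable.pred (S \<Otimes>\<^sub>M S) (\<lambda>(x, y). R n x y)"
    and AE_R: "\<And>n. AE x in \<Gamma> n. AE y in K n x. R n x y"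
  obtains P where "prob_space P" "sets P = sets (PiM UNIV (\<lambda>_::nat. S))"
    "\<And>n. distr P S (\<lambda>\<omega>. \<omega> n) = \<Gamma> n"
    "AE \<omega> in P. \<forall>n. R n (\<omega> n) (\<omega> (Suc n))"
proof -
  \<comment> \<open>\<open>Q i\<close> is the law of coordinate \<open>i\<close> given the
    coordinates with index below \<open>i\<close>.\<close>
  define Q where "Q i \<omega> = (case i of 0 \<Rightarrow> \<Gamma> 0 | Suc j \<Rightarrow> K j (\<omega> j))" for i and \<omega> :: "nat \<Rightarrow> 'b"
  have \<Gamma>_space: "\<Gamma> n \<in> space (subprob_algebra S)" for n
    using prob[of n] sets_\<Gamma>[of n] by (simp add: space_subprob_algebra prob_space_imp_subprob_space)
  have "Ionescu_Tulcea Q (\<lambda>_. S)"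
  proof (rule Ionescu_Tulcea.intro)
    fix i
    show "Q i \<in> measurable (PiM {0..<i} (\<lambda>_. S)) (subprob_algebra S)"
      unfolding Q_def using \<Gamma>_space by (cases i) auto
    fix x
    show "prob_space (Q i x)"
      unfolding Q_def by (cases i) (auto intro: prob prob_K)
  qed
  then interpret IT: Ionescu_Tulcea Q "\<lambda>_. S" .
  let ?u = "\<lambda>_::nat. undefined::'b"
  \<comment> \<open>\<open>?C n\<close> is the law of the coordinates with index below
    \<open>n\<close>, so coordinate \<open>n\<close> first appears in
    \<open>?C (Suc n)\<close>.\<close>
  let ?C = "\<lambda>n. IT.C 0 n ?u"
  have u: "?u \<in> space (PiM {0..<0} (\<lambda>_. S))" by (simp add: space_PiM)
  have sets_C[measurable_cong]: "sets (?C n) = sets (PiM {0..<n} (\<lambda>_. S))" for n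
    using IT.sets_C[OF u, of n] by simp
  have prob_C: "prob_space (?C n)" for n by (rule IT.prob_space_C[OF u])
  have C_Suc: "?C (Suc n) = ?C n \<bind> IT.eP n" for n by simp
  have ne: "space (?C n) \<noteq> {}" for n using prob_C by (rule prob_space.not_empty)
  have upd: "fun_upd \<omega> n \<in> measurable (Q n \<omega>) (PiM {0..<Suc n} (\<lambda>_. S))"
    if w: "\<omega> \<in> space (PiM {0..<n} (\<lambda>_. S))" for \<omega> n
    using w IT.sets_P[OF w]
    by (intro measurable_fun_upd[where J="{0..<n}"] measurable_const measurable_ident_sets) auto
  have law: "distr (?C (Suc n)) S (\<lambda>\<omega>. \<omega> n) = \<Gamma> n" for n
  proof -
    have "distr (?C (Suc n)) S (\<lambda>\<omega>. \<omega> n) = ?C n \<bind> (\<lambda>\<omega>. distr (IT.eP n \<omega>) S (\<lambda>\<omega>. \<omega> n))" for n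
      unfolding C_Suc
      by (rule distr_bind[where K="PiM {0..<Suc n} (\<lambda>_. S)"])
        (auto simp: ne intro!: measurable_cong_sets[THEN eqset_imp_iff, THEN iffD2, OF sets_C refl])
    also have "\<dots> n = ?C n \<bind> Q n" for n
    proof (rule bind_cong[OF refl])
      fix \<omega> assume "\<omega> \<in> space (?C n)"
      then have w: "\<omega> \<in> space (PiM {0..<n} (\<lambda>_. S))" using sets_C sets_eq_imp_space_eq by blast
      have [measurable_cong]: "sets (Q n \<omega>) = sets S" using IT.sets_P[OF w] .
      show "distr (IT.eP n \<omega>) S (\<lambda>\<omega>. \<omega> n) = Q n \<omega>"
        unfolding IT.eP_def
        by (subst distr_distr)
          (auto simp: comp_def \<open>sets (Q n \<omega>) = sets S\<close> intro!: distr_id2 upd w)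
    qed
    finally have *: "distr (?C (Suc n)) S (\<lambda>\<omega>. \<omega> n) = ?C n \<bind> Q n" for n .
    show ?thesis
    proof (induction n)
      case 0
      have "Q 0 = (\<lambda>_. \<Gamma> 0)" by (simp add: Q_def fun_eq_iff)
      then have "?C 0 \<bind> Q 0 = \<Gamma> 0"
        using prob[of 0] prob_C[of 0]
        by (simp add: bind_const' prob_space_imp_subprob_space del: IT.C.simps)
      then show ?case using *[of 0] by simp
    next
      case (Suc n)
      have Q_Suc: "Q (Suc n) = (\<lambda>\<omega>. K n (\<omega> n))" by (simp add: Q_def fun_eq_iff)
      have "?C (Suc n) \<bind> Q (Suc n) = distr (?C (Suc n)) S (\<lambda>\<omega>. \<omega> n) \<bind> K n"
        by (subst bind_distr[where K=S]) (auto simp: ne Q_Suc simp del: IT.C.simps)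
      then show ?case using * Suc step by (simp del: IT.C.simps)
    qed
  qed
  have AE_C: "AE \<omega> in ?C (Suc (Suc n)). R n (\<omega> n) (\<omega> (Suc n))" for n
  proof -
    have "AE \<omega> in ?C (Suc n). AE y in K n (\<omega> n). R n (\<omega> n) y"
      using AE_R[of n] unfolding law[symmetric, of n]
      by (rule AE_distrD[rotated]) (auto simp del: IT.C.simps)
    then have "AE \<omega> in ?C (Suc n). AE \<omega>' in IT.eP (Suc n) \<omega>. R n (\<omega>' n) (\<omega>' (Suc n))"
    proof (rule AE_mp[OF _ AE_I2[OF impI]])
      fix \<omega> assume "\<omega> \<in> space (?C (Suc n))" and R': "AE y in K n (\<omega> n). R n (\<omega> n) y"
      then have w: "\<omega> \<in> space (PiM {0..<Suc n} (\<lambda>_. S))" using sets_C sets_eq_imp_space_eq by blast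
      have [measurable_cong]: "sets (Q (Suc n) \<omega>) = sets S" using IT.sets_P[OF w] .
      have "Q (Suc n) \<omega> = K n (\<omega> n)" by (simp add: Q_def)
      with R' have "AE y in Q (Suc n) \<omega>. R n (\<omega> n) y" by (simp only:)
      then show "AE \<omega>' in IT.eP (Suc n) \<omega>. R n (\<omega>' n) (\<omega>' (Suc n))"
        unfolding IT.eP_def
        by (subst AE_distr_iff) (auto intro!: upd w)
    qed
    then show ?thesis
      unfolding C_Suc[of "Suc n"]
      by (subst AE_bind[where B="PiM {0..<Suc (Suc n)} (\<lambda>_. S)"]) (auto simp del: IT.C.simps)
  qed
  \<comment> \<open>Restricting the limit measure to an initial segment gives back the
    finite-dimensional law; marginals and almost sure properties thereby pass to the infinite
    product.\<close>
  have lim_C: "distr IT.PF.lim (PiM {0..<n} (\<lambda>_. S)) (\<lambda>\<omega>. restrict \<omega> {0..<n}) = ?C n" for n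
  proof (rule measure_eqI)
    fix A assume "A \<in> sets (distr IT.PF.lim (PiM {0..<n} (\<lambda>_. S)) (\<lambda>\<omega>. restrict \<omega> {0..<n}))"
    then have A[measurable]: "A \<in> sets (PiM {0..<n} (\<lambda>_. S))" by simp
    have "emeasure (distr IT.PF.lim (PiM {0..<n} (\<lambda>_. S)) (\<lambda>\<omega>. restrict \<omega> {0..<n})) A
       = emeasure IT.PF.lim (IT.PF.emb UNIV {0..<n} A)"
      by (subst emeasure_distr_restrict) auto
    also have "\<dots> = emeasure (IT.CI {0..<n}) A" by (rule IT.lim) auto
    also have "\<dots> = emeasure (?C n) (IT.PF.emb {0..<n} {0..<n} A)" by (rule IT.emeasure_CI) auto
    also have "IT.PF.emb {0..<n} {0..<n} A = A"
      using sets.sets_into_space[OF A] by (intro prod_emb_id) (auto simp: space_PiM)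
    finally show "emeasure (distr IT.PF.lim (PiM {0..<n} (\<lambda>_. S)) (\<lambda>\<omega>. restrict \<omega> {0..<n})) A
       = emeasure (?C n) A" .
  qed (simp add: sets_C del: IT.C.simps)
  have sets_lim[measurable_cong]: "sets IT.PF.lim = sets (PiM UNIV (\<lambda>_. S))" by simp
  show ?thesis
  proof (rule that[of IT.PF.lim])
    show "prob_space IT.PF.lim"
      by (rule prob_space_distrD[where N="PiM {0..<0} (\<lambda>_. S)" and f="\<lambda>\<omega>. restrict \<omega> {0..<0}"])
        (use lim_C[of 0] prob_C[of 0] in \<open>simp_all del: IT.C.simps\<close>)
    show "distr IT.PF.lim S (\<lambda>\<omega>. \<omega> n) = \<Gamma> n" for n
      unfolding law[symmetric] lim_C[symmetric]
      by (subst distr_distr) (auto simp: comp_def)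
    have "AE \<omega> in IT.PF.lim. R n (\<omega> n) (\<omega> (Suc n))" for n
    proof -
      have "AE \<omega> in IT.PF.lim. R n (restrict \<omega> {0..<Suc (Suc n)} n) (restrict \<omega> {0..<Suc (Suc n)} (Suc n))"
        using AE_C[of n] unfolding lim_C[symmetric]
        by (rule AE_distrD[rotated]) auto
      then show ?thesis by simp
    qed
    then show "AE \<omega> in IT.PF.lim. \<forall>n. R n (\<omega> n) (\<omega> (Suc n))"
      by (simp add: AE_all_countable)
  qed simp
qed

text \<open>The index of a point is that of the first member of a dense sequence within \<epsilon>/2
  of it, so points with equal index share a centre.\<close>

lemma fine_countable_partition:
  fixes \<epsilon> :: real
  assumes "\<epsilon> > 0"
  obtains i :: "'a::euclidean_space \<Rightarrow> nat"
  where "i \<in> measurable borel (count_space UNIV)" "\<And>x y. i x = i y \<Longrightarrow> dist x y \<le> \<epsilon>"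
proof -
  obtain D :: "'a set" where D: "countable D" "\<And>X. open X \<Longrightarrow> X \<noteq> {} \<Longrightarrow> \<exists>d\<in>D. d \<in> X"
    by (erule countable_dense_setE)
  have "D \<noteq> {}" using D(2)[of UNIV] by auto
  define d where "d = from_nat_into D"
  have ex: "\<exists>n. dist x (d n) < \<epsilon> / 2" for x
  proof -
    obtain z where "z \<in> D" "z \<in> ball x (\<epsilon> / 2)" using D(2)[of "ball x (\<epsilon> / 2)"] assms by auto
    then show ?thesis
      using from_nat_into_surj[OF D(1), of z] by (auto simp: d_def)
  qed
  define i where "i x = (LEAST n. dist x (d n) < \<epsilon> / 2)" for x
  have i: "dist x (d (i x)) < \<epsilon> / 2" for x
    unfolding i_def using ex by (rule LeastI_ex)
  show ?thesis
  proof
    show "i \<in> measurable borel (count_space UNIV)" unfolding i_def by measurable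
    show "dist x y \<le> \<epsilon>" if "i x = i y" for x y
      using i[of x] i[of y] that dist_triangle2[of x y "d (i x)"] by simp
  qed
qed

text \<open>\<open>snd\<close> under \<open>\<gamma> n\<close> and \<open>fst\<close> under
  \<open>\<gamma> (Suc n)\<close> both have law \<open>\<nu> (Suc n)\<close>, so their cells in a
  partition of mesh \<open>\<epsilon> n\<close> agree in law. \<open>matching_kernel\<close>
  continues each pair by one whose first point lies in the cell of the previous second
  point.\<close>

lemma approximate_gluing:
  fixes \<nu> :: "nat \<Rightarrow> 'a::euclidean_space measure"
  assumes \<gamma>: "\<And>n. \<gamma> n \<in> couplings (\<nu> n) (\<nu> (Suc n))" and \<epsilon>: "\<And>n. \<epsilon> n > 0"
  obtains P :: "(nat \<Rightarrow> 'a \<times> 'a) measure" where "prob_space P"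
    "sets P = sets (PiM UNIV (\<lambda>_. borel \<Otimes>\<^sub>M borel))"
    "\<And>n. distr P (borel \<Otimes>\<^sub>M borel) (\<lambda>\<omega>. \<omega> n) = \<gamma> n"
    "AE \<omega> in P. \<forall>n. dist (snd (\<omega> n)) (fst (\<omega> (Suc n))) \<le> \<epsilon> n"
proof -
  let ?S = "borel \<Otimes>\<^sub>M borel :: ('a \<times> 'a) measure"
  have "\<exists>i. i \<in> measurable borel (count_space (UNIV :: nat set)) \<and>
      (\<forall>x y::'a. i x = i y \<longrightarrow> dist x y \<le> \<epsilon> n)" for n
    using fine_countable_partition[OF \<epsilon>] by metis
  then obtain i :: "nat \<Rightarrow> 'a \<Rightarrow> nat"
    where i[measurable]: "\<And>n. i n \<in> measurable borel (count_space UNIV)"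
      and dist_i: "\<And>n x y. i n x = i n y \<Longrightarrow> dist x y \<le> \<epsilon> n"
    by metis
  have prob: "prob_space (\<gamma> n)" and sets[measurable_cong]: "sets (\<gamma> n) = sets ?S"
    and fst: "distr (\<gamma> n) borel fst = \<nu> n" and snd: "distr (\<gamma> n) borel snd = \<nu> (Suc n)" for n
    using \<gamma>[of n] by (auto simp: couplings_def)
  have "\<exists>K. K \<in> measurable ?S (subprob_algebra ?S) \<and> (\<forall>x. prob_space (K x)) \<and>
      \<gamma> n \<bind> K = \<gamma> (Suc n) \<and> (AE x in \<gamma> n. AE y in K x. i n (fst y) = i n (snd x))" for n
  proof -
    have "distr (\<gamma> n) (count_space UNIV) (\<lambda>x. i n (snd x)) = distr (distr (\<gamma> n) borel snd) (count_space UNIV) (i n)"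
      by (subst distr_distr) (auto simp: comp_def)
    also have "\<dots> = distr (distr (\<gamma> (Suc n)) borel fst) (count_space UNIV) (i n)"
      by (simp add: fst snd)
    also have "\<dots> = distr (\<gamma> (Suc n)) (count_space UNIV) (\<lambda>x. i n (fst x))"
      by (subst distr_distr) (auto simp: comp_def)
    finally have eq: "distr (\<gamma> n) (count_space UNIV) (\<lambda>x. i n (snd x))
      = distr (\<gamma> (Suc n)) (count_space UNIV) (\<lambda>x. i n (fst x))" .
    obtain K where K: "K \<in> measurable (\<gamma> n) (subprob_algebra (\<gamma> (Suc n)))" "\<And>x. prob_space (K x)"
        "\<gamma> n \<bind> K = \<gamma> (Suc n)" "AE x in \<gamma> n. AE y in K x. i n (fst y) = i n (snd x)"
      by (rule matching_kernel[OF prob prob _ _ eq]) auto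
    have "measurable (\<gamma> n) (subprob_algebra (\<gamma> (Suc n))) = measurable ?S (subprob_algebra ?S)"
      by (intro measurable_cong_sets sets arg_cong[where f=sets] subprob_algebra_cong)
    with K show ?thesis by (intro exI[of _ K]) simp
  qed
  then have "\<forall>n. \<exists>K. K \<in> measurable ?S (subprob_algebra ?S) \<and> (\<forall>x. prob_space (K x)) \<and>
      \<gamma> n \<bind> K = \<gamma> (Suc n) \<and> (AE x in \<gamma> n. AE y in K x. i n (fst y) = i n (snd x))" ..
  from choice[OF this] obtain K where K: "\<And>n. K n \<in> measurable ?S (subprob_algebra ?S)"
      "\<And>n x. prob_space (K n x)" "\<And>n. \<gamma> n \<bind> K n = \<gamma> (Suc n)"
      "\<And>n. AE x in \<gamma> n. AE y in K n x. i n (fst y) = i n (snd x)"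
    by blast
  have pred: "Measurable.pred (?S \<Otimes>\<^sub>M ?S) (\<lambda>(x, y). i n (fst y) = i n (snd x))" for n
  proof -
    have "(\<lambda>(x, y). i n (fst y) = i n (snd x)) = (\<lambda>p. \<exists>j. i n (fst (snd p)) = j \<and> i n (snd (fst p)) = j)"
      by auto
    also have "Measurable.pred (?S \<Otimes>\<^sub>M ?S) \<dots>" by measurable
    finally show ?thesis .
  qed
  obtain P where P: "prob_space P" "sets P = sets (PiM UNIV (\<lambda>_. ?S))"
    "\<And>n. distr P ?S (\<lambda>\<omega>. \<omega> n) = \<gamma> n"
    "AE \<omega> in P. \<forall>n. i n (fst (\<omega> (Suc n))) = i n (snd (\<omega> n))"
    by (rule markov_chain_exists[where \<Gamma>=\<gamma> and K=K and S="?S"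
          and R="\<lambda>n x y. i n (fst y) = i n (snd x)", OF prob sets K(1,2,3) pred K(4)]) blast
  show ?thesis
    using P(4) dist_i by (intro that[OF P(1-3)]) (auto elim!: eventually_mono)
qed

section \<open>The Wasserstein distance\<close>

text \<open>The joint law of \<open>X\<close> and \<open>Y\<close> is an admissible coupling. Upper
  bounds on distances are obtained below by constructing random variables on a common space.\<close>

lemma W2sq_distr_le:
  fixes X Y :: "'b \<Rightarrow> 'a::euclidean_space"
  assumes "prob_space P" and X[measurable]: "X \<in> borel_measurable P" and Y[measurable]: "Y \<in> borel_measurable P"
  shows "W2sq (distr P borel X) (distr P borel Y) \<le> (\<integral>\<^sup>+\<omega>. ennreal ((norm (X \<omega> - Y \<omega>))\<^sup>2) \<partial>P)"
proof -
  interpret prob_space P by fact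
  let ?\<gamma> = "distr P (borel \<Otimes>\<^sub>M borel) (\<lambda>\<omega>. (X \<omega>, Y \<omega>))"
  have "?\<gamma> \<in> couplings (distr P borel X) (distr P borel Y)"
    unfolding couplings_def by (auto simp: distr_distr comp_def intro!: prob_space_distr)
  moreover have "cost2 ?\<gamma> = (\<integral>\<^sup>+\<omega>. ennreal ((norm (X \<omega> - Y \<omega>))\<^sup>2) \<partial>P)"
    unfolding cost2_def by (subst nn_integral_distr) auto
  ultimately show ?thesis
    unfolding W2sq_def by (metis INF_lower)
qed

lemma couplings_prob_borel:
  assumes "\<gamma> \<in> couplings \<mu> \<nu>"
  shows "prob_borel \<mu>" "prob_borel \<nu>"
proof -
  interpret prob_space \<gamma> using assms by (simp add: couplings_def)
  have [measurable_cong]: "sets \<gamma> = sets (borel \<Otimes>\<^sub>M borel)"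
    and eq: "\<mu> = distr \<gamma> borel fst" "\<nu> = distr \<gamma> borel snd"
    using assms by (auto simp: couplings_def)
  show "prob_borel \<mu>" "prob_borel \<nu>"
    unfolding eq prob_borel_def by (auto intro!: prob_space_distr)
qed

lemma W2sq_finiteE:
  assumes "W2sq \<mu> \<nu> < c"
  obtains \<gamma> where "\<gamma> \<in> couplings \<mu> \<nu>" "cost2 \<gamma> < c"
  using assms by (auto simp: W2sq_def INF_less_iff)

lemma W2sq_commute: "W2sq \<mu> \<nu> = W2sq \<nu> (\<mu> :: 'a::euclidean_space measure)"
proof -
  have "W2sq \<nu> \<mu> \<le> W2sq \<mu> \<nu>" for \<mu> \<nu> :: "'a measure"
    unfolding W2sq_def[of \<mu>]
  proof (rule INF_greatest)
    fix \<gamma> assume "\<gamma> \<in> couplings \<mu> \<nu>"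
    then have "prob_space \<gamma>" and [measurable_cong]: "sets \<gamma> = sets (borel \<Otimes>\<^sub>M borel)"
      and eq: "\<mu> = distr \<gamma> borel fst" "\<nu> = distr \<gamma> borel snd"
      by (auto simp: couplings_def)
    have "W2sq (distr \<gamma> borel snd) (distr \<gamma> borel fst) \<le> (\<integral>\<^sup>+p. ennreal ((norm (snd p - fst p))\<^sup>2) \<partial>\<gamma>)"
      by (rule W2sq_distr_le[OF \<open>prob_space \<gamma>\<close>]) auto
    then show "W2sq \<nu> \<mu> \<le> cost2 \<gamma>" by (simp add: eq cost2_def norm_minus_commute)
  qed
  then show ?thesis by (intro antisym)
qed

lemma W2_commute: "W2 \<mu> \<nu> = W2 \<nu> \<mu>"
  by (simp add: W2_def W2sq_commute)

lemma W2_nonneg [simp]: "0 \<le> W2 \<mu> \<nu>"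
  by (simp add: W2_def)

lemma W2sq_eq_W2: "W2sq \<mu> \<nu> < \<infinity> \<Longrightarrow> W2sq \<mu> \<nu> = ennreal ((W2 \<mu> \<nu>)\<^sup>2)"
  by (simp add: W2_def)

lemma W2sq_refl: "prob_borel \<mu> \<Longrightarrow> W2sq \<mu> \<mu> = 0"
  using W2sq_distr_le[of \<mu> "\<lambda>x. x" "\<lambda>x. x"] distr_id2[of borel \<mu>]
  by (auto simp: prob_borel_def measurable_ident_sets)

text \<open>The Cauchy-Schwarz inequality in Sedrakyan's form; the gap is a sum of three squares.
  With bounds on three L2 norms as weights it replaces Minkowski's inequality.\<close>

lemma power2_sum3_le_weighted:
  fixes a b c p q r :: real
  assumes "p > 0" "q > 0" "r > 0"
  shows "(a + b + c)\<^sup>2 \<le> (p + q + r) * (a\<^sup>2 / p + b\<^sup>2 / q + c\<^sup>2 / r)"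
proof -
  have "(p + q + r) * (a\<^sup>2 / p + b\<^sup>2 / q + c\<^sup>2 / r) - (a + b + c)\<^sup>2
     = (q * a - p * b)\<^sup>2 / (p * q) + (r * a - p * c)\<^sup>2 / (p * r) + (r * b - q * c)\<^sup>2 / (q * r)"
    using assms by (simp add: field_simps power2_eq_square)
  also have "\<dots> \<ge> 0" using assms by simp
  finally show ?thesis by simp
qed

lemma W2_less_imp_coupling:
  assumes "W2sq \<mu> \<nu> < \<infinity>" "W2 \<mu> \<nu> < p"
  obtains \<gamma> where "\<gamma> \<in> couplings \<mu> \<nu>" "cost2 \<gamma> < ennreal (p\<^sup>2)"
proof -
  have "(W2 \<mu> \<nu>)\<^sup>2 < p\<^sup>2" using assms(2) by (intro power_strict_mono) auto
  then have "W2sq \<mu> \<nu> < ennreal (p\<^sup>2)"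
    using W2sq_eq_W2[OF assms(1)] by (simp add: ennreal_less_iff)
  then show ?thesis using that by (rule W2sq_finiteE)
qed

text \<open>Couplings of cost below \<open>p\<^sup>2\<close> and \<open>q\<^sup>2\<close> are glued
  with an error of at most \<open>r\<close> at \<rho>. The weighted inequality is applied under the
  integral, where its three terms contribute at most \<open>p + q + r\<close> times
  \<open>p\<close>, \<open>q\<close> and \<open>r\<close>.\<close>

lemma W2sq_triangle_approx:
  fixes \<mu> \<nu> \<rho> :: "'a::euclidean_space measure"
  assumes fin: "W2sq \<mu> \<rho> < \<infinity>" "W2sq \<rho> \<nu> < \<infinity>"
    and p: "W2 \<mu> \<rho> < p" and q: "W2 \<rho> \<nu> < q" and r: "0 < r"
  shows "W2sq \<mu> \<nu> \<le> ennreal ((p + q + r)\<^sup>2)"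
proof -
  obtain \<gamma>0 where g0: "\<gamma>0 \<in> couplings \<mu> \<rho>" "cost2 \<gamma>0 < ennreal (p\<^sup>2)"
    using W2_less_imp_coupling[OF fin(1) p] .
  obtain \<gamma>1 where g1: "\<gamma>1 \<in> couplings \<rho> \<nu>" "cost2 \<gamma>1 < ennreal (q\<^sup>2)"
    using W2_less_imp_coupling[OF fin(2) q] .
  have pq: "p > 0" "q > 0" using p q W2_nonneg le_less_trans by blast+
  \<comment> \<open>The gluing takes an infinite chain, so the two couplings are continued by
    self-couplings of \<nu>.\<close>
  have "W2sq \<nu> \<nu> < 1" using W2sq_refl[of \<nu>] couplings_prob_borel(2)[OF g1(1)] by simp
  then obtain \<gamma>2 where g2: "\<gamma>2 \<in> couplings \<nu> \<nu>" by (rule W2sq_finiteE)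
  define g where "g n = (if n = 0 then \<gamma>0 else if n = 1 then \<gamma>1 else \<gamma>2)" for n :: nat
  define m where "m n = (if n = 0 then \<mu> else if n = 1 then \<rho> else \<nu>)" for n :: nat
  have "g n \<in> couplings (m n) (m (Suc n))" for n
    using g0 g1 g2 by (auto simp: g_def m_def)
  then obtain P :: "(nat \<Rightarrow> 'a \<times> 'a) measure" where P: "prob_space P"
    and sets_P[measurable_cong]: "sets P = sets (PiM UNIV (\<lambda>_. borel \<Otimes>\<^sub>M borel))"
    and law: "\<And>n. distr P (borel \<Otimes>\<^sub>M borel) (\<lambda>\<omega>. \<omega> n) = g n"
    and near: "AE \<omega> in P. \<forall>n. dist (snd (\<omega> n)) (fst (\<omega> (Suc n))) \<le> r"
    using approximate_gluing[of g m "\<lambda>_. r" thesis] r by simp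
  interpret prob_space P by fact
  have cost: "cost2 (g n) = (\<integral>\<^sup>+\<omega>. ennreal ((norm (fst (\<omega> n) - snd (\<omega> n)))\<^sup>2) \<partial>P)" for n
    unfolding law[symmetric] cost2_def by (subst nn_integral_distr) auto
  have \<mu>: "distr P borel (\<lambda>\<omega>. fst (\<omega> 0)) = \<mu>"
  proof -
    have "distr P borel (\<lambda>\<omega>. fst (\<omega> 0)) = distr (g 0) borel fst"
      unfolding law[symmetric] by (subst distr_distr) (auto simp: comp_def)
    then show ?thesis using g0 by (simp add: g_def couplings_def)
  qed
  have \<nu>: "distr P borel (\<lambda>\<omega>. snd (\<omega> 1)) = \<nu>"
  proof -
    have "distr P borel (\<lambda>\<omega>. snd (\<omega> 1)) = distr (g 1) borel snd"
      unfolding law[symmetric] by (subst distr_distr) (auto simp: comp_def)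
    then show ?thesis using g1 by (simp add: g_def couplings_def)
  qed
  let ?t = "p + q + r"
  have "W2sq \<mu> \<nu> \<le> (\<integral>\<^sup>+\<omega>. ennreal ((norm (fst (\<omega> 0) - snd (\<omega> 1)))\<^sup>2) \<partial>P)"
    unfolding \<mu>[symmetric] \<nu>[symmetric] by (rule W2sq_distr_le[OF P]) auto
  also have "\<dots> \<le> (\<integral>\<^sup>+\<omega>. ennreal (?t / p) * ennreal ((norm (fst (\<omega> 0) - snd (\<omega> 0)))\<^sup>2)
      + ennreal (?t / q) * ennreal ((norm (fst (\<omega> 1) - snd (\<omega> 1)))\<^sup>2) + ennreal (?t * r) \<partial>P)"
  proof (rule nn_integral_mono_AE, use near in eventually_elim)
    case (elim \<omega>)
    let ?a = "norm (fst (\<omega> 0) - snd (\<omega> 0))" and ?b = "norm (fst (\<omega> 1) - snd (\<omega> 1))"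
    have "dist (snd (\<omega> 0)) (fst (\<omega> 1)) \<le> r" using elim[THEN spec, of 0] by simp
    moreover have "norm (fst (\<omega> 0) - snd (\<omega> 1)) \<le> ?a + ?b + dist (snd (\<omega> 0)) (fst (\<omega> 1))"
      using dist_triangle[of "fst (\<omega> 0)" "snd (\<omega> 1)" "snd (\<omega> 0)"]
        dist_triangle[of "snd (\<omega> 0)" "snd (\<omega> 1)" "fst (\<omega> 1)"] by (simp add: dist_norm)
    ultimately have "(norm (fst (\<omega> 0) - snd (\<omega> 1)))\<^sup>2 \<le> (?a + ?b + r)\<^sup>2"
      by (intro power_mono) auto
    also have "\<dots> \<le> ?t * (?a\<^sup>2 / p + ?b\<^sup>2 / q + r\<^sup>2 / r)"
      using pq r by (rule power2_sum3_le_weighted)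
    also have "\<dots> = ?t / p * ?a\<^sup>2 + ?t / q * ?b\<^sup>2 + ?t * r"
      using r by (simp add: field_simps power2_eq_square)
    finally show ?case using pq r
      by (simp add: ennreal_mult[symmetric] ennreal_plus[symmetric] ennreal_leI del: ennreal_plus)
  qed
  also have "\<dots> = ennreal (?t / p) * cost2 (g 0) + ennreal (?t / q) * cost2 (g 1) + ennreal (?t * r)"
    unfolding cost by (simp add: nn_integral_add nn_integral_cmult emeasure_space_1)
  also have "\<dots> \<le> ennreal (?t / p) * ennreal (p\<^sup>2) + ennreal (?t / q) * ennreal (q\<^sup>2) + ennreal (?t * r)"
    using g0 g1 by (intro add_mono mult_left_mono) (auto simp: g_def)
  also have "\<dots> = ennreal (?t\<^sup>2)"
    using pq r by (simp add: ennreal_mult[symmetric] ennreal_plus[symmetric] del: ennreal_plus)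
      (simp add: field_simps power2_eq_square)
  finally show ?thesis .
qed

text \<open>An excess \<open>e\<close> is spread evenly over \<open>p\<close>, \<open>q\<close> and
  the gluing error, and then sent to zero.\<close>

lemma W2_triangle:
  fixes \<mu> \<nu> \<rho> :: "'a::euclidean_space measure"
  assumes fin: "W2sq \<mu> \<rho> < \<infinity>" "W2sq \<rho> \<nu> < \<infinity>"
  shows "W2sq \<mu> \<nu> < \<infinity>" "W2 \<mu> \<nu> \<le> W2 \<mu> \<rho> + W2 \<rho> \<nu>"
proof -
  have *: "W2sq \<mu> \<nu> \<le> ennreal ((W2 \<mu> \<rho> + W2 \<rho> \<nu> + e)\<^sup>2)" if "e > 0" for e
    using W2sq_triangle_approx[OF fin, of "W2 \<mu> \<rho> + e / 3" "W2 \<rho> \<nu> + e / 3" "e / 3"] that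
    by (simp add: algebra_simps)
  from *[of 1] show 1: "W2sq \<mu> \<nu> < \<infinity>"
    by (rule le_less_trans) (simp_all add: ennreal_less_top)
  show "W2 \<mu> \<nu> \<le> W2 \<mu> \<rho> + W2 \<rho> \<nu>"
  proof (rule field_le_epsilon)
    fix e :: real assume "e > 0"
    with * have "(W2 \<mu> \<nu>)\<^sup>2 \<le> (W2 \<mu> \<rho> + W2 \<rho> \<nu> + e)\<^sup>2"
      unfolding W2sq_eq_W2[OF 1] by simp
    then show "W2 \<mu> \<nu> \<le> W2 \<mu> \<rho> + W2 \<rho> \<nu> + e"
      by (rule power2_le_imp_le) (simp add: \<open>e > 0\<close> less_imp_le)
  qed
qed

section \<open>Completeness of the Wasserstein space\<close>

text \<open>The increments form an absolutely convergent telescoping series, and the geometric tail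
  from \<open>n\<close> on has sum \<open>2 * c * (1/2) ^ n\<close>.\<close>

lemma convergent_of_geometric_increments:
  fixes X :: "nat \<Rightarrow> 'a::banach"
  assumes "\<And>n. norm (X n - X (Suc n)) \<le> c * (1/2) ^ n"
  shows "convergent X" "norm (X n - lim X) \<le> 2 * c * (1/2) ^ n"
proof -
  have geom: "(\<lambda>k. c * (1/2) ^ (n + k)) sums (2 * c * (1/2) ^ n)" for n
    using sums_mult[OF geometric_sums[of "1/2::real"], of "c * (1/2) ^ n"]
    by (simp add: power_add mult_ac)
  have bound: "norm (X (n + k) - X (n + Suc k)) \<le> c * (1/2) ^ (n + k)" for n k
    using assms[of "n + k"] unfolding add_Suc_right .
  have sum: "summable (\<lambda>k. norm (X (n + k) - X (n + Suc k)))" for n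
  proof (rule summable_comparison_test'[OF sums_summable[OF geom[of n]], of 0])
    show "norm (norm (X (n + k) - X (n + Suc k))) \<le> c * (1/2) ^ (n + k)" for k
      using bound[of n k] unfolding real_norm_def abs_norm_cancel .
  qed
  have "(\<lambda>k. X k - X (Suc k)) sums (\<Sum>k. X k - X (Suc k))"
    using sum[of 0] unfolding add_0 by (rule summable_sums[OF summable_norm_cancel])
  then have "(\<lambda>n. \<Sum>k<n. X k - X (Suc k)) \<longlonglongrightarrow> (\<Sum>k. X k - X (Suc k))"
    by (simp add: sums_def)
  moreover have "(\<Sum>k<n. X k - X (Suc k)) = X 0 - X n" for n
    by (rule sum_lessThan_telescope')
  ultimately have "(\<lambda>n. X 0 - X n) \<longlonglongrightarrow> (\<Sum>k. X k - X (Suc k))" by simp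
  from tendsto_diff[OF tendsto_const[of "X 0"] this] show "convergent X"
    by (auto simp: convergent_def)
  then have lim: "X \<longlonglongrightarrow> lim X" by (simp add: convergent_LIMSEQ_iff)
  then have "(\<lambda>k. X (n + k)) \<longlonglongrightarrow> lim X"
    using LIMSEQ_ignore_initial_segment[of X "lim X" n] by (simp add: add.commute)
  from telescope_sums'[OF this] have tel: "(\<lambda>k. X (n + k) - X (n + Suc k)) sums (X n - lim X)"
    by simp
  have "norm (X n - lim X) \<le> (\<Sum>k. norm (X (n + k) - X (n + Suc k)))"
    unfolding sums_unique[OF tel] by (rule summable_norm[OF sum])
  also have "\<dots> \<le> (\<Sum>k. c * (1/2) ^ (n + k))"
    by (rule suminf_le[OF _ sum sums_summable[OF geom]]) (rule bound)
  also have "\<dots> = 2 * c * (1/2) ^ n" using sums_unique[OF geom] by simp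
  finally show "norm (X n - lim X) \<le> 2 * c * (1/2) ^ n" .
qed

lemma ennreal_term_le_suminf: "f n \<le> (\<Sum>n. f n :: ennreal)"
  using sum_le_suminf[OF summableI, of "{n}" f] by simp

text \<open>Gluing realizes all \<open>\<nu> n\<close> on one probability space as laws of random
  variables \<open>X n\<close> with geometrically small increments in L2. These converge almost
  surely, and the law of their limit is the limit measure.\<close>

lemma W2sq_complete:
  fixes \<nu> :: "nat \<Rightarrow> 'a::euclidean_space measure"
  assumes small: "\<And>n. W2sq (\<nu> n) (\<nu> (Suc n)) < ennreal ((1/16) ^ n)"
  obtains \<nu>' where "prob_borel \<nu>'" "\<And>n. W2sq (\<nu> n) \<nu>' \<le> ennreal (24 * (1/4) ^ n)"
proof -
  have "\<exists>\<gamma>. \<gamma> \<in> couplings (\<nu> n) (\<nu> (Suc n)) \<and> cost2 \<gamma> < ennreal ((1/16) ^ n)" for n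
    using W2sq_finiteE[OF small[of n]] by metis
  then obtain \<gamma> where \<gamma>: "\<And>n. \<gamma> n \<in> couplings (\<nu> n) (\<nu> (Suc n))"
    and cost_small: "\<And>n. cost2 (\<gamma> n) < ennreal ((1/16) ^ n)"
    by metis
  \<comment> \<open>The gluing error \<open>(1/4) ^ n\<close> is chosen so that its square matches
    the bound \<open>(1/16) ^ n\<close> on the costs.\<close>
  obtain P :: "(nat \<Rightarrow> 'a \<times> 'a) measure" where P: "prob_space P"
    and sets_P[measurable_cong]: "sets P = sets (PiM UNIV (\<lambda>_. borel \<Otimes>\<^sub>M borel))"
    and law: "\<And>n. distr P (borel \<Otimes>\<^sub>M borel) (\<lambda>\<omega>. \<omega> n) = \<gamma> n"
    and near: "AE \<omega> in P. \<forall>n. dist (snd (\<omega> n)) (fst (\<omega> (Suc n))) \<le> (1/4) ^ n"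
    using approximate_gluing[of \<gamma> \<nu> "\<lambda>n. (1/4) ^ n" thesis] \<gamma> by simp
  interpret prob_space P by fact
  define X where "X n \<omega> = fst (\<omega> n)" for n and \<omega> :: "nat \<Rightarrow> 'a \<times> 'a"
  have X[measurable]: "X n \<in> borel_measurable P" for n unfolding X_def by measurable
  have law_X: "distr P borel (X n) = \<nu> n" for n
  proof -
    have "distr P borel (X n) = distr (\<gamma> n) borel fst"
      unfolding law[symmetric] X_def by (subst distr_distr) (auto simp: comp_def)
    then show ?thesis using \<gamma>[of n] by (simp add: couplings_def)
  qed
  have cost: "cost2 (\<gamma> n) = (\<integral>\<^sup>+\<omega>. ennreal ((norm (fst (\<omega> n) - snd (\<omega> n)))\<^sup>2) \<partial>P)" for n
    unfolding law[symmetric] cost2_def by (subst nn_integral_distr) auto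
  \<comment> \<open>The weight \<open>4 ^ n\<close> leaves means of order \<open>(1/4) ^ n\<close>,
    still summable, while a finite weighted sum forces the increments themselves to decay like
    \<open>(1/2) ^ n\<close>.\<close>
  have incr: "(\<integral>\<^sup>+\<omega>. ennreal (4 ^ n * (norm (X n \<omega> - X (Suc n) \<omega>))\<^sup>2) \<partial>P) \<le> ennreal (4 * (1/4) ^ n)" for n
  proof -
    have "(\<integral>\<^sup>+\<omega>. ennreal (4 ^ n * (norm (X n \<omega> - X (Suc n) \<omega>))\<^sup>2) \<partial>P)
      \<le> (\<integral>\<^sup>+\<omega>. ennreal (2 * 4 ^ n) * ennreal ((norm (fst (\<omega> n) - snd (\<omega> n)))\<^sup>2) + ennreal (2 * (1/4) ^ n) \<partial>P)"
    proof (rule nn_integral_mono_AE, use near in eventually_elim)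
      case (elim \<omega>)
      let ?a = "norm (fst (\<omega> n) - snd (\<omega> n))" and ?b = "dist (snd (\<omega> n)) (fst (\<omega> (Suc n)))"
      have "norm (X n \<omega> - X (Suc n) \<omega>) \<le> ?a + ?b"
        using dist_triangle[of "fst (\<omega> n)" "fst (\<omega> (Suc n))" "snd (\<omega> n)"] by (simp add: dist_norm X_def)
      also have "?b \<le> (1/4) ^ n" using elim by simp
      finally have "(norm (X n \<omega> - X (Suc n) \<omega>))\<^sup>2 \<le> (?a + (1/4) ^ n)\<^sup>2"
        by (intro power_mono) auto
      also have "\<dots> \<le> 2 * ?a\<^sup>2 + 2 * ((1/4) ^ n)\<^sup>2"
        using zero_le_power2[of "?a - (1/4) ^ n"] by (simp add: power2_eq_square algebra_simps)
      finally have "4 ^ n * (norm (X n \<omega> - X (Suc n) \<omega>))\<^sup>2 \<le> 4 ^ n * (2 * ?a\<^sup>2 + 2 * ((1/4) ^ n)\<^sup>2)"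
        by (intro mult_left_mono) auto
      also have "\<dots> = 2 * 4 ^ n * ?a\<^sup>2 + 2 * (1/4) ^ n"
        by (simp add: power2_eq_square algebra_simps power_divide)
      finally show ?case
        by (simp add: ennreal_mult[symmetric] ennreal_plus[symmetric] ennreal_leI del: ennreal_plus)
    qed
    also have "\<dots> = ennreal (2 * 4 ^ n) * cost2 (\<gamma> n) + ennreal (2 * (1/4) ^ n)"
      unfolding cost by (simp add: nn_integral_add nn_integral_cmult emeasure_space_1)
    also have "\<dots> \<le> ennreal (2 * 4 ^ n) * ennreal ((1/16) ^ n) + ennreal (2 * (1/4) ^ n)"
      using cost_small[of n] by (intro add_mono mult_left_mono) auto
    also have "\<dots> = ennreal (2 * (4 ^ n * (1/16) ^ n) + 2 * (1/4) ^ n)"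
      by (simp add: ennreal_mult[symmetric] ennreal_plus[symmetric] mult_ac del: ennreal_plus)
    also have "4 ^ n * (1/16) ^ n = ((1/4) ^ n :: real)"
      by (simp add: power_mult_distrib[symmetric])
    finally show ?thesis by simp
  qed
  define S where "S \<omega> = (\<Sum>n. ennreal (4 ^ n * (norm (X n \<omega> - X (Suc n) \<omega>))\<^sup>2))" for \<omega>
  have S[measurable]: "S \<in> borel_measurable P" unfolding S_def by measurable
  have int_S: "(\<integral>\<^sup>+\<omega>. S \<omega> \<partial>P) \<le> ennreal 6"
  proof -
    have "(\<integral>\<^sup>+\<omega>. S \<omega> \<partial>P) = (\<Sum>n. \<integral>\<^sup>+\<omega>. ennreal (4 ^ n * (norm (X n \<omega> - X (Suc n) \<omega>))\<^sup>2) \<partial>P)"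
      unfolding S_def by (rule nn_integral_suminf) auto
    also have "\<dots> \<le> (\<Sum>n. ennreal (4 * (1/4) ^ n))" by (intro suminf_le incr) auto
    also have "\<dots> = ennreal (\<Sum>n. 4 * (1/4) ^ n)"
      by (rule suminf_ennreal2) (auto intro!: summable_mult summable_geometric)
    also have "(\<Sum>n. 4 * (1/4) ^ n) = (16/3 :: real)"
      by (subst suminf_mult) (auto simp: suminf_geometric intro!: summable_geometric)
    also have "ennreal (16/3) \<le> ennreal 6" by (rule ennreal_leI) simp
    finally show ?thesis .
  qed
  have "AE \<omega> in P. S \<omega> \<noteq> \<infinity>"
    using int_S by (intro nn_integral_PInf_AE S) (auto simp: top_unique)
  then have dist_lim: "AE \<omega> in P. \<forall>n. ennreal ((norm (X n \<omega> - lim (\<lambda>n. X n \<omega>)))\<^sup>2) \<le> ennreal (4 * (1/4) ^ n) * S \<omega>"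
  proof eventually_elim
    case (elim \<omega>)
    then obtain s where s: "S \<omega> = ennreal s" "s \<ge> 0" by (cases "S \<omega>") auto
    have half: "((1/2) ^ n)\<^sup>2 = (1/4 :: real) ^ n" for n
      unfolding power2_eq_square power_mult_distrib[symmetric] by simp
    have "norm (X n \<omega> - X (Suc n) \<omega>) \<le> sqrt s * (1/2) ^ n" for n
    proof (rule power2_le_imp_le)
      have "ennreal (4 ^ n * (norm (X n \<omega> - X (Suc n) \<omega>))\<^sup>2) \<le> S \<omega>"
        unfolding S_def by (rule ennreal_term_le_suminf)
      then have "4 ^ n * (norm (X n \<omega> - X (Suc n) \<omega>))\<^sup>2 \<le> s"
        using s(2) unfolding s(1) by (subst (asm) ennreal_le_iff)
      then have "(norm (X n \<omega> - X (Suc n) \<omega>))\<^sup>2 \<le> s * (1/4) ^ n"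
        by (simp add: field_simps)
      also have "\<dots> = (sqrt s * (1/2) ^ n)\<^sup>2"
        unfolding power_mult_distrib half using s(2) by simp
      finally show "(norm (X n \<omega> - X (Suc n) \<omega>))\<^sup>2 \<le> (sqrt s * (1/2) ^ n)\<^sup>2" .
    qed (use s in simp)
    from convergent_of_geometric_increments(2)[of "\<lambda>n. X n \<omega>", OF this]
    have *: "norm (X n \<omega> - lim (\<lambda>n. X n \<omega>)) \<le> 2 * sqrt s * (1/2) ^ n" for n .
    show ?case
    proof
      fix n
      have "(norm (X n \<omega> - lim (\<lambda>n. X n \<omega>)))\<^sup>2 \<le> (2 * sqrt s * (1/2) ^ n)\<^sup>2"
        using * by (intro power_mono) auto
      also have "\<dots> = 4 * (1/4) ^ n * s"
        unfolding power_mult_distrib half using s(2) by simp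
      finally show "ennreal ((norm (X n \<omega> - lim (\<lambda>n. X n \<omega>)))\<^sup>2) \<le> ennreal (4 * (1/4) ^ n) * S \<omega>"
        using s by (simp add: ennreal_mult[symmetric] ennreal_leI)
    qed
  qed
  define L where "L \<omega> = lim (\<lambda>n. X n \<omega>)" for \<omega>
  have L[measurable]: "L \<in> borel_measurable P" unfolding L_def by measurable
  show ?thesis
  proof
    show "prob_borel (distr P borel L)"
      unfolding prob_borel_def by (auto intro!: prob_space_distr)
    fix n
    have "W2sq (\<nu> n) (distr P borel L) \<le> (\<integral>\<^sup>+\<omega>. ennreal ((norm (X n \<omega> - L \<omega>))\<^sup>2) \<partial>P)"
      unfolding law_X[symmetric] by (rule W2sq_distr_le[OF P]) auto
    also have "\<dots> \<le> (\<integral>\<^sup>+\<omega>. ennreal (4 * (1/4) ^ n) * S \<omega> \<partial>P)"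
      unfolding L_def by (rule nn_integral_mono_AE, use dist_lim in eventually_elim) auto
    also have "\<dots> = ennreal (4 * (1/4) ^ n) * (\<integral>\<^sup>+\<omega>. S \<omega> \<partial>P)"
      by (rule nn_integral_cmult) auto
    \<comment> \<open>The constant 24 is the 4 of \<open>dist_lim\<close> times the 6 of
      \<open>int_S\<close>.\<close>
    also have "\<dots> \<le> ennreal (4 * (1/4) ^ n) * ennreal 6"
      by (intro mult_left_mono int_S) auto
    also have "\<dots> = ennreal (24 * (1/4) ^ n)"
      by (subst ennreal_mult[symmetric]) auto
    finally show "W2sq (\<nu> n) (distr P borel L) \<le> ennreal (24 * (1/4) ^ n)" .
  qed
qed

section \<open>The metric space \<open>P2\<close> and its generalized geodesics\<close>

lemma P2_W2sq_finite: "\<mu> \<in> P2 \<omega>0 \<Longrightarrow> \<nu> \<in> P2 \<omega>0 \<Longrightarrow> W2sq \<mu> \<nu> < \<infinity>"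
  using W2_triangle(1)[of \<mu> \<omega>0 \<nu>] W2sq_commute[of \<omega>0 \<nu>] by (simp add: P2_def)

lemma P2_I: "\<mu> \<in> P2 \<omega>0 \<Longrightarrow> W2sq \<mu> \<nu> < \<infinity> \<Longrightarrow> prob_borel \<nu> \<Longrightarrow> \<nu> \<in> P2 \<omega>0"
  using W2_triangle(1)[of \<nu> \<mu> \<omega>0] W2sq_commute[of \<mu> \<nu>] by (simp add: P2_def)

lemma P2_triangle:
  "\<mu> \<in> P2 \<omega>0 \<Longrightarrow> \<rho> \<in> P2 \<omega>0 \<Longrightarrow> \<nu> \<in> P2 \<omega>0 \<Longrightarrow> W2 \<mu> \<nu> \<le> W2 \<mu> \<rho> + W2 \<rho> \<nu>"
  by (rule W2_triangle(2)) (rule P2_W2sq_finite; assumption)+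

lemma P2_W2_refl: "\<mu> \<in> P2 \<omega>0 \<Longrightarrow> W2 \<mu> \<mu> = 0"
  by (simp add: W2_def W2sq_refl P2_def)

text \<open>Stewart's identity, the parallelogram law at \<alpha> = 1/2: the squared distance from a
  fixed point is uniformly convex along segments.\<close>

lemma power2_norm_diff_convex_comb:
  fixes x y z :: "'a::real_inner"
  shows "(norm (x - ((1 - \<alpha>) *\<^sub>R y + \<alpha> *\<^sub>R z)))\<^sup>2 + \<alpha> * (1 - \<alpha>) * (norm (y - z))\<^sup>2
    = (1 - \<alpha>) * (norm (x - y))\<^sup>2 + \<alpha> * (norm (x - z))\<^sup>2"
  unfolding power2_norm_eq_inner
  by (simp add: inner_simps inner_commute algebra_simps power2_eq_square)

text \<open>The first coordinate of \<open>w\<close> is shared by two optimal couplings, so the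
  pointwise identity integrates to an exact formula. Pairing the first coordinate with the
  interpolated point, or the second with the third, gives couplings that need not be optimal, hence
  inequalities.\<close>

lemma gen_geod_W2:
  assumes w: "w \<in> transport_plans \<rho> \<mu>0 \<mu>1" and fin: "W2sq \<rho> \<mu>0 < \<infinity>" "W2sq \<rho> \<mu>1 < \<infinity>"
    and \<alpha>: "\<alpha> \<in> {0..1}"
  shows "prob_borel (gen_geod w \<alpha>)" "W2sq \<rho> (gen_geod w \<alpha>) < \<infinity>"
    "(W2 \<rho> (gen_geod w \<alpha>))\<^sup>2 \<le> (1 - \<alpha>) * (W2 \<rho> \<mu>0)\<^sup>2 + \<alpha> * (W2 \<rho> \<mu>1)\<^sup>2 - \<alpha> * (1 - \<alpha>) * W2plan_sq w"
    "(W2 \<mu>0 \<mu>1)\<^sup>2 \<le> W2plan_sq w"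
proof -
  have w_prob: "prob_space w" and w_sets[measurable_cong]: "sets w = sets (borel \<Otimes>\<^sub>M (borel \<Otimes>\<^sub>M borel))"
    and opt0: "distr w (borel \<Otimes>\<^sub>M borel) (\<lambda>(x1, x2, x3). (x1, x2)) \<in> opt_couplings \<rho> \<mu>0"
    and opt1: "distr w (borel \<Otimes>\<^sub>M borel) (\<lambda>(x1, x2, x3). (x1, x3)) \<in> opt_couplings \<rho> \<mu>1"
    using w by (auto simp: transport_plans_def)
  interpret prob_space w by fact
  let ?x1 = "\<lambda>p. fst p" and ?x2 = "\<lambda>p. fst (snd p)" and ?x3 = "\<lambda>p. snd (snd p)"
  let ?z = "\<lambda>p. (1 - \<alpha>) *\<^sub>R ?x2 p + \<alpha> *\<^sub>R ?x3 p"
  have law1: "distr w borel ?x1 = \<rho>" and law2: "distr w borel ?x2 = \<mu>0"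
    using opt0 by (auto simp: opt_couplings_def couplings_def distr_distr comp_def split_beta)
  have law3: "distr w borel ?x3 = \<mu>1"
    using opt1 by (auto simp: opt_couplings_def couplings_def distr_distr comp_def split_beta)
  have lawz: "distr w borel ?z = gen_geod w \<alpha>"
    unfolding gen_geod_def by (rule arg_cong[where f="distr w borel"]) auto
  have "cost2 (distr w (borel \<Otimes>\<^sub>M borel) (\<lambda>(x1, x2, x3). (x1, x2))) = W2sq \<rho> \<mu>0"
    using opt0 by (simp add: opt_couplings_def)
  then have c12: "(\<integral>\<^sup>+p. ennreal ((norm (?x1 p - ?x2 p))\<^sup>2) \<partial>w) = ennreal ((W2 \<rho> \<mu>0)\<^sup>2)"
    unfolding cost2_def W2sq_eq_W2[OF fin(1)] by (subst (asm) nn_integral_distr) (auto simp: split_beta)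
  have "cost2 (distr w (borel \<Otimes>\<^sub>M borel) (\<lambda>(x1, x2, x3). (x1, x3))) = W2sq \<rho> \<mu>1"
    using opt1 by (simp add: opt_couplings_def)
  then have c13: "(\<integral>\<^sup>+p. ennreal ((norm (?x1 p - ?x3 p))\<^sup>2) \<partial>w) = ennreal ((W2 \<rho> \<mu>1)\<^sup>2)"
    unfolding cost2_def W2sq_eq_W2[OF fin(2)] by (subst (asm) nn_integral_distr) (auto simp: split_beta)
  let ?I = "\<integral>\<^sup>+p. ennreal ((norm (?x2 p - ?x3 p))\<^sup>2) \<partial>w"
  have convex: "(\<integral>\<^sup>+p. ennreal ((norm (?x1 p - ((1 - \<beta>) *\<^sub>R ?x2 p + \<beta> *\<^sub>R ?x3 p)))\<^sup>2) \<partial>w) + ennreal (\<beta> * (1 - \<beta>)) * ?I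
      = ennreal ((1 - \<beta>) * (W2 \<rho> \<mu>0)\<^sup>2 + \<beta> * (W2 \<rho> \<mu>1)\<^sup>2)" if \<beta>: "\<beta> \<in> {0..1}" for \<beta>
  proof -
    have "(\<integral>\<^sup>+p. ennreal ((norm (?x1 p - ((1 - \<beta>) *\<^sub>R ?x2 p + \<beta> *\<^sub>R ?x3 p)))\<^sup>2) \<partial>w) + ennreal (\<beta> * (1 - \<beta>)) * ?I
      = (\<integral>\<^sup>+p. ennreal ((norm (?x1 p - ((1 - \<beta>) *\<^sub>R ?x2 p + \<beta> *\<^sub>R ?x3 p)))\<^sup>2)
          + ennreal (\<beta> * (1 - \<beta>)) * ennreal ((norm (?x2 p - ?x3 p))\<^sup>2) \<partial>w)"
      by (simp add: nn_integral_add nn_integral_cmult)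
    also have "\<dots> = (\<integral>\<^sup>+p. ennreal (1 - \<beta>) * ennreal ((norm (?x1 p - ?x2 p))\<^sup>2)
          + ennreal \<beta> * ennreal ((norm (?x1 p - ?x3 p))\<^sup>2) \<partial>w)"
      using \<beta> by (intro nn_integral_cong)
        (simp add: ennreal_mult[symmetric] ennreal_plus[symmetric] power2_norm_diff_convex_comb del: ennreal_plus)
    also have "\<dots> = ennreal (1 - \<beta>) * ennreal ((W2 \<rho> \<mu>0)\<^sup>2) + ennreal \<beta> * ennreal ((W2 \<rho> \<mu>1)\<^sup>2)"
      by (simp add: nn_integral_add nn_integral_cmult c12 c13)
    also have "\<dots> = ennreal ((1 - \<beta>) * (W2 \<rho> \<mu>0)\<^sup>2 + \<beta> * (W2 \<rho> \<mu>1)\<^sup>2)"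
      using \<beta> by (simp add: ennreal_mult[symmetric] ennreal_plus[symmetric] del: ennreal_plus)
    finally show ?thesis .
  qed
  \<comment> \<open>The value 1/2 keeps the coefficient of \<open>?I\<close> positive, which fails
    at \<alpha> = 0 and \<alpha> = 1. Finiteness matters because the \<open>enn2real\<close> in
    \<open>W2plan_sq\<close> would send infinity to 0.\<close>
  have "ennreal (1/4) * ?I \<noteq> \<infinity>"
    using convex[of "1/2"] by (auto simp: ennreal_plus[symmetric] simp del: ennreal_plus)
  then have I_fin: "?I \<noteq> \<infinity>" by (auto simp: ennreal_mult_eq_top_iff)
  then have I: "?I = ennreal (W2plan_sq w)" by (simp add: W2plan_sq_def less_top)
  have plan_nonneg: "0 \<le> W2plan_sq w" by (simp add: W2plan_sq_def)
  show "prob_borel (gen_geod w \<alpha>)"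
    unfolding lawz[symmetric] prob_borel_def by (auto intro!: prob_space_distr)
  have le_int: "W2sq \<rho> (gen_geod w \<alpha>) \<le> (\<integral>\<^sup>+p. ennreal ((norm (?x1 p - ?z p))\<^sup>2) \<partial>w)"
    unfolding lawz[symmetric] law1[symmetric] by (rule W2sq_distr_le[OF w_prob]) auto
  have "W2sq \<rho> (gen_geod w \<alpha>) + ennreal (\<alpha> * (1 - \<alpha>) * W2plan_sq w)
      \<le> (\<integral>\<^sup>+p. ennreal ((norm (?x1 p - ?z p))\<^sup>2) \<partial>w) + ennreal (\<alpha> * (1 - \<alpha>)) * ?I"
    unfolding I using \<alpha> plan_nonneg le_int by (simp add: ennreal_mult add_mono)
  also have "\<dots> = ennreal ((1 - \<alpha>) * (W2 \<rho> \<mu>0)\<^sup>2 + \<alpha> * (W2 \<rho> \<mu>1)\<^sup>2)"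
    by (rule convex[OF \<alpha>])
  finally have *: "W2sq \<rho> (gen_geod w \<alpha>) + ennreal (\<alpha> * (1 - \<alpha>) * W2plan_sq w)
      \<le> ennreal ((1 - \<alpha>) * (W2 \<rho> \<mu>0)\<^sup>2 + \<alpha> * (W2 \<rho> \<mu>1)\<^sup>2)" .
  then show fin': "W2sq \<rho> (gen_geod w \<alpha>) < \<infinity>"
    by (cases "W2sq \<rho> (gen_geod w \<alpha>)") (auto simp: top_unique)
  show "(W2 \<rho> (gen_geod w \<alpha>))\<^sup>2 \<le> (1 - \<alpha>) * (W2 \<rho> \<mu>0)\<^sup>2 + \<alpha> * (W2 \<rho> \<mu>1)\<^sup>2 - \<alpha> * (1 - \<alpha>) * W2plan_sq w"
    using * \<alpha> plan_nonneg unfolding W2sq_eq_W2[OF fin']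
    by (subst (asm) ennreal_plus[symmetric], simp, simp) (subst (asm) ennreal_le_iff, auto)
  have "W2sq \<mu>0 \<mu>1 \<le> ?I"
    unfolding law2[symmetric] law3[symmetric] by (rule W2sq_distr_le[OF w_prob]) auto
  then show "(W2 \<mu>0 \<mu>1)\<^sup>2 \<le> W2plan_sq w"
    unfolding I using W2sq_eq_W2[of \<mu>0 \<mu>1] plan_nonneg
    by (metis ennreal_le_iff ennreal_less_top infinity_ennreal_def le_less_trans)
qed

section \<open>Proximal maps of energies convex along generalized geodesics\<close>

text \<open>Let \<alpha> decrease to 0. This extracts first-order conditions from convexity
  inequalities already divided by \<alpha>.\<close>

lemma le_if_le_add_small_mult:
  fixes x y z :: real
  assumes "\<And>\<alpha>. 0 < \<alpha> \<Longrightarrow> \<alpha> < 1 \<Longrightarrow> x \<le> y + \<alpha> * z"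
  shows "x \<le> y"
proof (rule tendsto_lowerbound)
  show "((\<lambda>\<alpha>. y + \<alpha> * z) \<longlongrightarrow> y) (at_right 0)"
    by (rule tendsto_eq_intros refl | simp)+
  show "\<forall>\<^sub>F \<alpha> in at_right 0. x \<le> y + \<alpha> * z"
    unfolding eventually_at_right_field by (rule exI[of _ 1]) (auto intro: assms)
qed simp

text \<open>With X the proximal point of x for the step \<tau> and Y that of y for the step
  \<open>h\<close>, the numbers \<open>a\<close>, \<open>b\<close>, \<open>u\<close>,
  \<open>w\<close>, \<open>d\<close> are the distances from x to y, x to X, y to X, y to Y and X to
  Y.\<close>

lemma asymmetric_estimate:
  fixes a b u w d s k h \<tau> ey eX eY :: real
  assumes evi_Y: "(1 - k * h) * d\<^sup>2 + w\<^sup>2 + 2 * h * eY \<le> u\<^sup>2 + 2 * h * eX"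
    and evi_X: "(1 - k * \<tau>) * u\<^sup>2 + b\<^sup>2 + 2 * \<tau> * eX \<le> a\<^sup>2 + 2 * \<tau> * ey"
    and slope_Y: "ey \<le> eY + s * w + k / 2 * w\<^sup>2"
    and slope_X: "ey \<le> eX + s * u + k / 2 * u\<^sup>2"
    and tri: "u \<le> a + b"
    and pos: "0 \<le> u" "0 \<le> k" "0 < h" "h \<le> \<tau>" "k * \<tau> < 1"
  shows "(1 - k * h)\<^sup>2 * d\<^sup>2 \<le> h / \<tau> * inverse (1 - k * \<tau>) * a\<^sup>2 + (\<tau> - h) / \<tau> * u\<^sup>2 + h\<^sup>2 * s\<^sup>2 / (1 - k * h)"
proof -
  have \<tau>: "0 < \<tau>" using pos by simp
  have "k * h \<le> k * \<tau>" using pos by (intro mult_left_mono)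
  then have kh: "0 < 1 - k * h" using pos by simp
  have k\<tau>: "0 < 1 - k * \<tau>" using pos by simp
  have e1: "(1 - k * h) * ((1 - k * h) * d\<^sup>2 + w\<^sup>2 + 2 * h * eY) \<le> (1 - k * h) * (u\<^sup>2 + 2 * h * eX)"
    using evi_Y kh by simp
  have e2: "h / \<tau> * ((1 - k * \<tau>) * u\<^sup>2 + b\<^sup>2 + 2 * \<tau> * eX) \<le> h / \<tau> * (a\<^sup>2 + 2 * \<tau> * ey)"
    using evi_X pos \<tau> by (intro mult_left_mono) auto
  have e2': "h / \<tau> * (1 - k * \<tau>) * u\<^sup>2 + h / \<tau> * b\<^sup>2 + 2 * h * eX \<le> h / \<tau> * a\<^sup>2 + 2 * h * ey"
    using e2 \<tau> by (simp add: field_simps)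
  \<comment> \<open>In the sum of \<open>e1\<close> and \<open>e2'\<close> the energies regroup as
    \<open>2 * h * (1 - k * h) * (ey - eY) + 2 * k * h\<^sup>2 * (ey - eX)\<close>, which dictates
    the factors of \<open>e3\<close> and \<open>e4\<close>.\<close>
  have e3: "2 * h * (1 - k * h) * ey \<le> 2 * h * (1 - k * h) * (eY + s * w + k / 2 * w\<^sup>2)"
    using slope_Y pos kh by (intro mult_left_mono) auto
  have e4: "2 * k * h\<^sup>2 * ey \<le> 2 * k * h\<^sup>2 * (eX + s * u + k / 2 * u\<^sup>2)"
    using slope_X pos by (intro mult_left_mono) auto
  txt \<open>The factor \<open>1 / (1 - k \<tau>)\<close> in the claim is exactly what absorbs \<open>k h u\<^sup>2\<close>.\<close>
  have e5: "k * h * u\<^sup>2 \<le> k * h / (1 - k * \<tau>) * a\<^sup>2 + h / \<tau> * b\<^sup>2"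
  proof -
    have "k * h * u\<^sup>2 \<le> k * h * (a + b)\<^sup>2"
      using tri pos by (intro mult_left_mono power_mono) auto
    \<comment> \<open>The added square is the gap in Young's inequality with weights
      \<open>k * \<tau>\<close> and \<open>1 - k * \<tau>\<close>; in this form nothing is divided
      by \<open>k\<close>, which may be 0.\<close>
    also have "\<dots> \<le> k * h * (a + b)\<^sup>2 + h / (\<tau> * (1 - k * \<tau>)) * (k * \<tau> * a - (1 - k * \<tau>) * b)\<^sup>2"
      using pos \<tau> k\<tau> by simp
    also have "\<dots> = k * h / (1 - k * \<tau>) * a\<^sup>2 + h / \<tau> * b\<^sup>2"
      using \<tau> k\<tau> by (simp add: divide_simps) (simp add: algebra_simps power2_eq_square)
    finally show ?thesis .
  qed
  \<comment> \<open>Completing the square. The coefficient \<open>1 - k * h\<close> of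
    \<open>w\<^sup>2\<close> is what is left of 1 after the quadratic term of the slope
    bound.\<close>
  have e6: "2 * h * s * w - (1 - k * h) * w\<^sup>2 \<le> h\<^sup>2 * s\<^sup>2 / (1 - k * h)"
  proof -
    have "0 \<le> (h * s - (1 - k * h) * w)\<^sup>2 / (1 - k * h)" using kh by simp
    also have "\<dots> = h\<^sup>2 * s\<^sup>2 / (1 - k * h) - (2 * h * s * w - (1 - k * h) * w\<^sup>2)"
      using kh by (simp add: divide_simps) (simp add: algebra_simps power2_eq_square)
    finally show ?thesis by simp
  qed
  have e7: "2 * h * s * u - (1 - k * h) * u\<^sup>2 \<le> h\<^sup>2 * s\<^sup>2 / (1 - k * h)"
  proof -
    have "0 \<le> (h * s - (1 - k * h) * u)\<^sup>2 / (1 - k * h)" using kh by simp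
    also have "\<dots> = h\<^sup>2 * s\<^sup>2 / (1 - k * h) - (2 * h * s * u - (1 - k * h) * u\<^sup>2)"
      using kh by (simp add: divide_simps) (simp add: algebra_simps power2_eq_square)
    finally show ?thesis by simp
  qed
  \<comment> \<open>The weights \<open>1 - k * h\<close> and \<open>k * h\<close> add up to 1, so
    both errors merge into the single term \<open>C\<close>.\<close>
  have e6': "(1 - k * h) * (2 * h * s * w - (1 - k * h) * w\<^sup>2) \<le> (1 - k * h) * (h\<^sup>2 * s\<^sup>2 / (1 - k * h))"
    using e6 kh by (intro mult_left_mono) auto
  have e7': "k * h * (2 * h * s * u - (1 - k * h) * u\<^sup>2) \<le> k * h * (h\<^sup>2 * s\<^sup>2 / (1 - k * h))"
    using e7 pos by (intro mult_left_mono) auto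
  define C where "C = h\<^sup>2 * s\<^sup>2 / (1 - k * h)"
  have coef: "k * h / (1 - k * \<tau>) * a\<^sup>2 + h / \<tau> * a\<^sup>2 = h / \<tau> * inverse (1 - k * \<tau>) * a\<^sup>2"
    using \<tau> k\<tau> by (simp add: divide_simps) (simp add: algebra_simps)
  have coef_u: "(\<tau> - h) / \<tau> * u\<^sup>2 = (1 - k * h) * u\<^sup>2 - h / \<tau> * (1 - k * \<tau>) * u\<^sup>2"
    using \<tau> by (simp add: divide_simps) (simp add: algebra_simps)
  define A B U where "A = k * h / (1 - k * \<tau>) * a\<^sup>2 + h / \<tau> * a\<^sup>2" and "B = h / \<tau> * b\<^sup>2"
    and "U = h / \<tau> * (1 - k * \<tau>) * u\<^sup>2"
  have "(1 - k * h)\<^sup>2 * d\<^sup>2 \<le> A + ((1 - k * h) * u\<^sup>2 - U) + C"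
    using e1 e2' e3 e4 e5 e6' e7' unfolding C_def[symmetric] A_def B_def[symmetric] U_def[symmetric]
    by (simp add: algebra_simps power2_eq_square)
  then show ?thesis unfolding coef_u coef[symmetric] A_def U_def C_def .
qed

section \<open>Minimizers and the discrete variational inequality\<close>

text \<open>Separates being a minimizer from \<open>prox\<close>, whose value is an arbitrary choice
  unless a minimizer exists.\<close>

definition is_prox :: "'a::euclidean_space measure \<Rightarrow> ('a measure \<Rightarrow> ereal) \<Rightarrow> real \<Rightarrow> 'a measure \<Rightarrow> 'a measure \<Rightarrow> bool" where
  "is_prox \<omega>0 E h y Y \<longleftrightarrow> Y \<in> P2 \<omega>0 \<and>
    (\<forall>\<rho>\<in>P2 \<omega>0. ereal ((W2 y Y)\<^sup>2 / (2 * h)) + E Y \<le> ereal ((W2 y \<rho>)\<^sup>2 / (2 * h)) + E \<rho>)"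

locale gg_convex_energy =
  fixes \<omega>0 :: "'a::euclidean_space measure" and E :: "'a measure \<Rightarrow> ereal" and lam :: real
  assumes energy: "energy_on \<omega>0 E" and lsc: "lsc_E \<omega>0 E" and convex: "gg_convex \<omega>0 E lam"
begin

abbreviation k :: real where "k \<equiv> max 0 (- lam)"

lemma E_finite: "\<mu> \<in> P2 \<omega>0 \<Longrightarrow> E \<mu> \<le> ereal c \<Longrightarrow> \<exists>e. E \<mu> = ereal e"
  using energy by (cases "E \<mu>") (auto simp: energy_on_def)

text \<open>Convexity in real terms, with the plan reduced to its curve \<open>g\<close> and its
  squared cost \<open>p\<close>. Finite energy at the ends gives finite energy along the curve, and
  \<open>lam\<close> may be lowered to \<open>- k\<close> because the plan cost is
  nonnegative.\<close>

lemma convex_curve: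
  assumes "\<rho> \<in> P2 \<omega>0" "\<mu>0 \<in> P2 \<omega>0" "\<mu>1 \<in> P2 \<omega>0" and e: "E \<mu>0 = ereal e0" "E \<mu>1 = ereal e1"
  obtains g p where "\<And>\<alpha>. \<alpha> \<in> {0..1} \<Longrightarrow> g \<alpha> \<in> P2 \<omega>0"
    "\<And>\<alpha>. \<alpha> \<in> {0..1} \<Longrightarrow> (W2 \<rho> (g \<alpha>))\<^sup>2 \<le> (1 - \<alpha>) * (W2 \<rho> \<mu>0)\<^sup>2 + \<alpha> * (W2 \<rho> \<mu>1)\<^sup>2 - \<alpha> * (1 - \<alpha>) * p"
    "\<And>\<alpha>. \<alpha> \<in> {0..1} \<Longrightarrow> \<exists>e. E (g \<alpha>) = ereal e \<and> e \<le> (1 - \<alpha>) * e0 + \<alpha> * e1 + \<alpha> * (1 - \<alpha>) * (k / 2) * p"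
    "(W2 \<mu>0 \<mu>1)\<^sup>2 \<le> p"
proof -
  from convex assms obtain w where w: "w \<in> transport_plans \<rho> \<mu>0 \<mu>1"
    and Ew: "\<forall>\<alpha>\<in>{0..1}. E (gen_geod w \<alpha>) \<le> ereal (1 - \<alpha>) * E \<mu>0 + ereal \<alpha> * E \<mu>1
           - ereal (\<alpha> * (1 - \<alpha>) * (lam / 2) * W2plan_sq w)"
    unfolding gg_convex_def by blast
  have fin: "W2sq \<rho> \<mu>0 < \<infinity>" "W2sq \<rho> \<mu>1 < \<infinity>" using assms P2_W2sq_finite by blast+
  note gg = gen_geod_W2[OF w fin]
  have P2: "gen_geod w \<alpha> \<in> P2 \<omega>0" if "\<alpha> \<in> {0..1}" for \<alpha>
    using P2_I[OF assms(1) gg(2) gg(1)] that by blast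
  show ?thesis
  proof (rule that[of "gen_geod w" "W2plan_sq w"])
    fix \<alpha> :: real assume \<alpha>: "\<alpha> \<in> {0..1}"
    let ?p = "W2plan_sq w"
    have le: "E (gen_geod w \<alpha>) \<le> ereal ((1 - \<alpha>) * e0 + \<alpha> * e1 - \<alpha> * (1 - \<alpha>) * (lam / 2) * ?p)"
      using Ew \<alpha> by (auto simp: e)
    have "\<alpha> * (1 - \<alpha>) * ((- lam) / 2) * ?p \<le> \<alpha> * (1 - \<alpha>) * (k / 2) * ?p"
      using \<alpha> by (intro mult_right_mono mult_left_mono) (auto simp: W2plan_sq_def)
    then show "\<exists>e. E (gen_geod w \<alpha>) = ereal e \<and> e \<le> (1 - \<alpha>) * e0 + \<alpha> * e1 + \<alpha> * (1 - \<alpha>) * (k / 2) * ?p"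
      using E_finite[OF P2[OF \<alpha>] le] le by auto
  qed (use P2 gg(3) gg(4)[of 0] in auto)
qed

text \<open>The minimality of \<open>Y\<close> is tested along a generalized geodesic from
  \<open>Y\<close> to \<open>v\<close> with base \<open>y\<close>; the inequality is divided by
  \<alpha>, which then tends to 0.\<close>

lemma prox_evi:
  assumes "y \<in> P2 \<omega>0" "v \<in> P2 \<omega>0" and Y: "is_prox \<omega>0 E h y Y"
    and e: "E Y = ereal eY" "E v = ereal e1" and h: "0 < h" "k * h < 1"
  shows "(1 - k * h) * (W2 Y v)\<^sup>2 + (W2 y Y)\<^sup>2 + 2 * h * eY \<le> (W2 y v)\<^sup>2 + 2 * h * e1"
proof -
  have "Y \<in> P2 \<omega>0" using Y by (simp add: is_prox_def)
  from convex_curve[OF assms(1) this assms(2) e] obtain g p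
    where P2: "\<And>\<alpha>. \<alpha> \<in> {0..1} \<Longrightarrow> g \<alpha> \<in> P2 \<omega>0"
      and W: "\<And>\<alpha>. \<alpha> \<in> {0..1} \<Longrightarrow> (W2 y (g \<alpha>))\<^sup>2 \<le> (1 - \<alpha>) * (W2 y Y)\<^sup>2 + \<alpha> * (W2 y v)\<^sup>2 - \<alpha> * (1 - \<alpha>) * p"
      and Eg: "\<And>\<alpha>. \<alpha> \<in> {0..1} \<Longrightarrow> \<exists>e. E (g \<alpha>) = ereal e \<and> e \<le> (1 - \<alpha>) * eY + \<alpha> * e1 + \<alpha> * (1 - \<alpha>) * (k / 2) * p"
      and p: "(W2 Y v)\<^sup>2 \<le> p" by blast
  let ?K = k
  have "(1 - ?K * h) * p + (W2 y Y)\<^sup>2 + 2 * h * eY \<le> (W2 y v)\<^sup>2 + 2 * h * e1"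
  proof (rule le_if_le_add_small_mult)
    fix \<alpha> :: real assume \<alpha>: "0 < \<alpha>" "\<alpha> < 1"
    then obtain e' where e': "E (g \<alpha>) = ereal e'"
        "e' \<le> (1 - \<alpha>) * eY + \<alpha> * e1 + \<alpha> * (1 - \<alpha>) * (?K / 2) * p"
      using Eg[of \<alpha>] by auto
    have "(W2 y Y)\<^sup>2 / (2 * h) + eY \<le> (W2 y (g \<alpha>))\<^sup>2 / (2 * h) + e'"
      using Y P2[of \<alpha>] \<alpha> by (auto simp: is_prox_def e' e)
    then have "2 * h * ((W2 y Y)\<^sup>2 / (2 * h) + eY) \<le> 2 * h * ((W2 y (g \<alpha>))\<^sup>2 / (2 * h) + e')"
      using h by (intro mult_left_mono) auto
    then have "(W2 y Y)\<^sup>2 + 2 * h * eY \<le> (W2 y (g \<alpha>))\<^sup>2 + 2 * h * e'"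
      using h by (simp add: distrib_left)
    also have "\<dots> \<le> (1 - \<alpha>) * (W2 y Y)\<^sup>2 + \<alpha> * (W2 y v)\<^sup>2 - \<alpha> * (1 - \<alpha>) * p
        + 2 * h * ((1 - \<alpha>) * eY + \<alpha> * e1 + \<alpha> * (1 - \<alpha>) * (?K / 2) * p)"
      using W[of \<alpha>] e'(2) \<alpha> h by (intro add_mono mult_left_mono) auto
    finally have "\<alpha> * ((1 - ?K * h) * p + (W2 y Y)\<^sup>2 + 2 * h * eY)
        \<le> \<alpha> * ((W2 y v)\<^sup>2 + 2 * h * e1 + \<alpha> * ((1 - ?K * h) * p))"
      by (simp add: field_simps)
    then show "(1 - ?K * h) * p + (W2 y Y)\<^sup>2 + 2 * h * eY \<le> (W2 y v)\<^sup>2 + 2 * h * e1 + \<alpha> * ((1 - ?K * h) * p)"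
      using \<alpha> by simp
  qed
  \<comment> \<open>The plan cost may be lowered to the squared distance because its coefficient is
    positive.\<close>
  moreover have "(1 - ?K * h) * (W2 Y v)\<^sup>2 \<le> (1 - ?K * h) * p"
    using p h by (intro mult_left_mono) auto
  ultimately show ?thesis by linarith
qed

section \<open>Slope bounds\<close>

text \<open>A global form of the slope at \<open>y\<close> being at most \<open>s\<close>, with the
  defect of convexity as quadratic term. Unlike the limsup it can be tested at distant points; where
  the energy is infinite the inequality is trivial.\<close>

definition slope_bound :: "'a measure \<Rightarrow> real \<Rightarrow> bool" where
  "slope_bound y s \<longleftrightarrow> y \<in> P2 \<omega>0 \<and> 0 \<le> s \<and> (\<exists>e. E y = ereal e \<and>
     (\<forall>v\<in>P2 \<omega>0. \<forall>e1. E v = ereal e1 \<longrightarrow> e \<le> e1 + s * W2 y v + k / 2 * (W2 y v)\<^sup>2))"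

text \<open>Lower semicontinuity along the constant sequence \<open>v\<close>. It stands in for the
  fact that measures at distance zero coincide.\<close>

lemma E_le_if_W2_eq_0:
  assumes "y \<in> P2 \<omega>0" "v \<in> P2 \<omega>0" "W2 y v = 0"
  shows "E y \<le> E v"
proof -
  have "E y \<le> liminf (\<lambda>n::nat. E v)"
    using lsc[unfolded lsc_E_def, rule_format, of y "\<lambda>_. v"] assms by (simp add: W2_commute[of v])
  then show ?thesis by (simp add: Liminf_const)
qed

text \<open>The absolute value covers the junk case of an isolated \<open>\<mu>\<close>, where the supremum over the empty
  set makes the slope \<open>-\<infinity>\<close>.\<close>

lemma slope_bound_slope:
  assumes \<mu>: "\<mu> \<in> P2 \<omega>0" and "E \<mu> < \<infinity>" and slope: "slope \<omega>0 E \<mu> < \<infinity>"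
  shows "slope_bound \<mu> \<bar>real_of_ereal (slope \<omega>0 E \<mu>)\<bar>"
proof -
  let ?s = "\<bar>real_of_ereal (slope \<omega>0 E \<mu>)\<bar>"
  obtain e where e: "E \<mu> = ereal e"
    using energy \<mu> \<open>E \<mu> < \<infinity>\<close> by (cases "E \<mu>") (auto simp: energy_on_def)
  have "e \<le> e1 + ?s * W2 \<mu> v + k / 2 * (W2 \<mu> v)\<^sup>2" if v: "v \<in> P2 \<omega>0" and e1: "E v = ereal e1" for v e1
  proof (cases "W2 \<mu> v = 0")
    case True
    then show ?thesis using E_le_if_W2_eq_0[OF \<mu> v] by (simp add: e e1)
  next
    case False
    define d where "d = W2 \<mu> v"
    have d: "0 < d" using False W2_nonneg[of \<mu> v] unfolding d_def by linarith
    \<comment> \<open>For \<open>s\<close> strictly above the slope, the local bound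
      \<open>near\<close> holds in a whole ball of radius \<open>r\<close>; the strictness is
      removed at the end.\<close>
    have above: "e \<le> e1 + s * d + k / 2 * d\<^sup>2" if s: "?s < s" for s
    proof -
      have "slope \<omega>0 E \<mu> < ereal s" using s slope by (cases "slope \<omega>0 E \<mu>") auto
      then obtain r where r: "0 < r" "(SUP \<nu>\<in>{\<nu>\<in>P2 \<omega>0. 0 < W2 \<mu> \<nu> \<and> W2 \<mu> \<nu> < r}.
          max 0 (E \<mu> - E \<nu>) / ereal (W2 \<mu> \<nu>)) < ereal s"
        unfolding slope_def INF_less_iff by auto
      have near: "e \<le> e' + s * W2 \<mu> \<nu>" if "\<nu> \<in> P2 \<omega>0" "W2 \<mu> \<nu> < r" "E \<nu> = ereal e'" for \<nu> e'
      proof (cases "W2 \<mu> \<nu> = 0")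
        case True
        then show ?thesis using E_le_if_W2_eq_0[OF \<mu> that(1)] that(3) by (simp add: e)
      next
        case False
        then have pos: "0 < W2 \<mu> \<nu>" using W2_nonneg[of \<mu> \<nu>] by linarith
        have "max 0 (E \<mu> - E \<nu>) / ereal (W2 \<mu> \<nu>) \<le> (SUP \<nu>\<in>{\<nu>\<in>P2 \<omega>0. 0 < W2 \<mu> \<nu> \<and> W2 \<mu> \<nu> < r}.
          max 0 (E \<mu> - E \<nu>) / ereal (W2 \<mu> \<nu>))"
          using that pos by (intro SUP_upper) auto
        then have "max 0 (E \<mu> - E \<nu>) / ereal (W2 \<mu> \<nu>) < ereal s" using r(2) by (rule le_less_trans)
        moreover have "ereal ((e - e') / W2 \<mu> \<nu>) \<le> max 0 (E \<mu> - E \<nu>) / ereal (W2 \<mu> \<nu>)"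
          using ereal_divide_right_mono[of "ereal (e - e')" "max 0 (E \<mu> - E \<nu>)" "ereal (W2 \<mu> \<nu>)"] pos
          by (simp add: e that(3))
        ultimately have "ereal ((e - e') / W2 \<mu> \<nu>) < ereal s" by (simp only: le_less_trans)
        then have "(e - e') / W2 \<mu> \<nu> < s" by simp
        then show ?thesis using pos by (simp add: field_simps)
      qed
      from convex_curve[OF \<mu> \<mu> v e e1] obtain g p
        where P2: "\<And>\<alpha>. \<alpha> \<in> {0..1} \<Longrightarrow> g \<alpha> \<in> P2 \<omega>0"
          and W: "\<And>\<alpha>. \<alpha> \<in> {0..1} \<Longrightarrow> (W2 \<mu> (g \<alpha>))\<^sup>2 \<le> (1 - \<alpha>) * (W2 \<mu> \<mu>)\<^sup>2 + \<alpha> * (W2 \<mu> v)\<^sup>2 - \<alpha> * (1 - \<alpha>) * p"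
          and Eg: "\<And>\<alpha>. \<alpha> \<in> {0..1} \<Longrightarrow> \<exists>e'. E (g \<alpha>) = ereal e' \<and> e' \<le> (1 - \<alpha>) * e + \<alpha> * e1 + \<alpha> * (1 - \<alpha>) * (k / 2) * p"
          and p: "(W2 \<mu> v)\<^sup>2 \<le> p" by blast
      have W': "(W2 \<mu> (g \<alpha>))\<^sup>2 \<le> \<alpha> * d\<^sup>2 - \<alpha> * (1 - \<alpha>) * p" if "\<alpha> \<in> {0..1}" for \<alpha>
        using W[OF that] P2_W2_refl[OF \<mu>] by (simp add: d_def)
      \<comment> \<open>The base of the curve is its starting point \<mu>, so the left side of
        \<open>W'\<close> is nonnegative and vanishing \<alpha> forces the plan cost down to the
        squared distance.\<close>
      have "p \<le> d\<^sup>2"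
      proof (rule le_if_le_add_small_mult)
        fix \<alpha> :: real assume \<alpha>: "0 < \<alpha>" "\<alpha> < 1"
        have "0 \<le> \<alpha> * d\<^sup>2 - \<alpha> * (1 - \<alpha>) * p"
          by (rule order_trans[OF zero_le_power2 W']) (use \<alpha> in simp)
        then have "\<alpha> * p \<le> \<alpha> * (d\<^sup>2 + \<alpha> * p)" by (simp add: algebra_simps)
        then show "p \<le> d\<^sup>2 + \<alpha> * p" using \<alpha> by simp
      qed
      with p have p: "p = d\<^sup>2" by (simp add: d_def)
      \<comment> \<open>Small enough for \<open>g \<alpha>\<close>, at distance at most
        \<open>\<alpha> * d\<close> from \<mu>, to lie in the ball where \<open>near\<close>
        applies.\<close>
      define \<alpha> where "\<alpha> = min (1/2) (r / (2 * d))"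
      have \<alpha>: "0 < \<alpha>" "\<alpha> < 1" "\<alpha> * d < r"
      proof -
        have "\<alpha> * d \<le> r / (2 * d) * d" unfolding \<alpha>_def using d by (intro mult_right_mono) auto
        also have "\<dots> < r" using d r by (simp add: field_simps)
        finally show "\<alpha> * d < r" .
      qed (use d r in \<open>auto simp: \<alpha>_def\<close>)
      then have \<alpha>': "\<alpha> \<in> {0..1}" by simp
      have "(W2 \<mu> (g \<alpha>))\<^sup>2 \<le> (\<alpha> * d)\<^sup>2"
        using W'[OF \<alpha>'] by (simp add: p algebra_simps power2_eq_square)
      then have W: "W2 \<mu> (g \<alpha>) \<le> \<alpha> * d" by (rule power2_le_imp_le) (use \<alpha> d in simp)
      obtain e' where e': "E (g \<alpha>) = ereal e'" "e' \<le> (1 - \<alpha>) * e + \<alpha> * e1 + \<alpha> * (1 - \<alpha>) * (k / 2) * d\<^sup>2"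
        using Eg[OF \<alpha>'] p by auto
      have "e \<le> e' + s * W2 \<mu> (g \<alpha>)"
        using near[OF P2[OF \<alpha>'] _ e'(1)] W \<alpha> by simp
      also have "s * W2 \<mu> (g \<alpha>) \<le> s * (\<alpha> * d)"
        using W order_trans[OF abs_ge_zero less_imp_le[OF s]] by (rule mult_left_mono)
      finally have "e \<le> (1 - \<alpha>) * e + \<alpha> * e1 + \<alpha> * (1 - \<alpha>) * (k / 2) * d\<^sup>2 + s * (\<alpha> * d)"
        using e'(2) by simp
      also have "\<alpha> * (1 - \<alpha>) * (k / 2) * d\<^sup>2 \<le> \<alpha> * 1 * (k / 2) * d\<^sup>2"
        using \<alpha> by (intro mult_right_mono mult_left_mono) auto
      finally have "\<alpha> * e \<le> \<alpha> * (e1 + s * d + k / 2 * d\<^sup>2)"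
        by (simp add: algebra_simps)
      then show ?thesis using \<alpha> by simp
    qed
    have "e \<le> e1 + ?s * d + k / 2 * d\<^sup>2 + \<alpha> * d" if "0 < \<alpha>" for \<alpha>
      using above[of "?s + \<alpha>"] that unfolding distrib_right by linarith
    then have "e \<le> e1 + ?s * d + k / 2 * d\<^sup>2"
      by (rule le_if_le_add_small_mult)
    then show ?thesis by (simp add: d_def)
  qed
  then show ?thesis unfolding slope_bound_def using \<mu> e abs_ge_zero by blast
qed

section \<open>Existence of proximal points\<close>

text \<open>The direct method for \<open>\<Phi>\<close>: the slope bound bounds it from below,
  uniform convexity replaces compactness, and lower semicontinuity passes to the limit.\<close>

lemma exists_prox:
  assumes "slope_bound y s" and h: "0 < h" "k * h < 1"
  shows "\<exists>Y. is_prox \<omega>0 E h y Y"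
proof -
  from assms(1) obtain e where y: "y \<in> P2 \<omega>0" and e: "E y = ereal e"
    and lower: "\<And>v e1. v \<in> P2 \<omega>0 \<Longrightarrow> E v = ereal e1 \<Longrightarrow> e \<le> e1 + s * W2 y v + k / 2 * (W2 y v)\<^sup>2"
    unfolding slope_bound_def by blast
  let ?K = k
  define \<Phi> where "\<Phi> v = ereal ((W2 y v)\<^sup>2 / (2 * h)) + E v" for v
  define i where "i = (INF v\<in>P2 \<omega>0. \<Phi> v)"
  \<comment> \<open>\<open>q\<close> equals \<open>1 / (2 * h) - k / 2\<close>, the quadratic growth
    that remains after the defect of convexity.\<close>
  define q where "q = (1 - ?K * h) / (2 * h)"
  have q: "0 < q" using h by (simp add: q_def)
  have "ereal (e - s\<^sup>2 / (4 * q)) \<le> \<Phi> v" if v: "v \<in> P2 \<omega>0" for v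
  proof (cases "E v")
    case (real e1)
    have "e \<le> e1 + s * W2 y v + ?K / 2 * (W2 y v)\<^sup>2" by (rule lower[OF v real])
    moreover have "(W2 y v)\<^sup>2 / (2 * h) = q * (W2 y v)\<^sup>2 + ?K / 2 * (W2 y v)\<^sup>2"
      using h(1) by (simp add: q_def field_simps)
    moreover have "0 \<le> (2 * q * W2 y v - s)\<^sup>2 / (4 * q)" using q by simp
    moreover have "(2 * q * W2 y v - s)\<^sup>2 / (4 * q) = q * (W2 y v)\<^sup>2 - s * W2 y v + s\<^sup>2 / (4 * q)"
      using q by (simp add: field_simps power2_eq_square)
    ultimately show ?thesis by (simp add: \<Phi>_def real)
  qed (use energy v in \<open>auto simp: energy_on_def \<Phi>_def\<close>)
  then have "ereal (e - s\<^sup>2 / (4 * q)) \<le> i" unfolding i_def by (rule INF_greatest)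
  moreover have "i \<le> \<Phi> y" unfolding i_def using y by (rule INF_lower)
  moreover have "\<Phi> y < \<infinity>" by (simp add: \<Phi>_def e)
  ultimately obtain ri where ri: "i = ereal ri" by (cases i) auto
  have i_le: "ereal ri \<le> \<Phi> v" if "v \<in> P2 \<omega>0" for v
    using INF_lower[of v "P2 \<omega>0" \<Phi>] that by (simp add: i_def[symmetric] ri)
  \<comment> \<open>Chosen so that \<open>small\<close> bounds successive squared distances by
    \<open>17/64 * (1/16) ^ n\<close>, below the \<open>(1/16) ^ n\<close> that
    \<open>W2sq_complete\<close> asks for.\<close>
  define \<delta> where "\<delta> n = q / 8 * (1/16) ^ n" for n :: nat
  have \<delta>: "0 < \<delta> n" for n using q by (simp add: \<delta>_def)
  have "\<exists>v e1. v \<in> P2 \<omega>0 \<and> E v = ereal e1 \<and> (W2 y v)\<^sup>2 / (2 * h) + e1 < ri + \<delta> n" for n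
  proof -
    have "i < ereal (ri + \<delta> n)" using \<delta> by (simp add: ri)
    then obtain v where v: "v \<in> P2 \<omega>0" "\<Phi> v < ereal (ri + \<delta> n)"
      unfolding i_def INF_less_iff by auto
    then show ?thesis
      using energy by (cases "E v") (auto simp: \<Phi>_def energy_on_def)
  qed
  then obtain v ev where v: "\<And>n. v n \<in> P2 \<omega>0" and Ev: "\<And>n. E (v n) = ereal (ev n)"
    and \<Phi>v: "\<And>n. (W2 y (v n))\<^sup>2 / (2 * h) + ev n < ri + \<delta> n"
    by metis
  have small: "(W2 (v n) (v m))\<^sup>2 * q < 2 * (\<delta> n + \<delta> m)" for n m
  proof -
    from convex_curve[OF y v[of n] v[of m] Ev Ev] obtain g p
      where P2: "\<And>\<alpha>. \<alpha> \<in> {0..1} \<Longrightarrow> g \<alpha> \<in> P2 \<omega>0"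
        and W: "\<And>\<alpha>. \<alpha> \<in> {0..1} \<Longrightarrow> (W2 y (g \<alpha>))\<^sup>2 \<le> (1 - \<alpha>) * (W2 y (v n))\<^sup>2 + \<alpha> * (W2 y (v m))\<^sup>2 - \<alpha> * (1 - \<alpha>) * p"
        and Eg: "\<And>\<alpha>. \<alpha> \<in> {0..1} \<Longrightarrow> \<exists>e'. E (g \<alpha>) = ereal e' \<and> e' \<le> (1 - \<alpha>) * ev n + \<alpha> * ev m + \<alpha> * (1 - \<alpha>) * (k / 2) * p"
        and p: "(W2 (v n) (v m))\<^sup>2 \<le> p" by blast
    \<comment> \<open>At the midpoint convexity gains \<open>p * q / 4\<close>, but the infimum
      \<open>ri\<close> limits the gain to the mean of the two excesses over it.\<close>
    have half: "(1/2 :: real) \<in> {0..1}" by simp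
    obtain e' where e': "E (g (1/2)) = ereal e'" "e' \<le> ev n / 2 + ev m / 2 + ?K / 8 * p"
      using Eg[OF half] by auto
    have "ri \<le> (W2 y (g (1/2)))\<^sup>2 / (2 * h) + e'"
      using i_le[OF P2[OF half]] by (simp add: \<Phi>_def e')
    also have "\<dots> \<le> ((W2 y (v n))\<^sup>2 / 2 + (W2 y (v m))\<^sup>2 / 2 - p / 4) / (2 * h) + (ev n / 2 + ev m / 2 + ?K / 8 * p)"
      using W[OF half] e'(2) h by (intro add_mono divide_right_mono) auto
    also have "\<dots> = ((W2 y (v n))\<^sup>2 / (2 * h) + ev n) / 2 + ((W2 y (v m))\<^sup>2 / (2 * h) + ev m) / 2 - p * q / 4"
      using h(1) by (simp add: q_def field_simps)
    finally have "p * q < 2 * (\<delta> n + \<delta> m)" using \<Phi>v[of n] \<Phi>v[of m] by (simp add: field_simps)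
    moreover have "(W2 (v n) (v m))\<^sup>2 * q \<le> p * q" using p q by (intro mult_right_mono) auto
    ultimately show ?thesis by linarith
  qed
  have "W2sq (v n) (v (Suc n)) < ennreal ((1/16) ^ n)" for n
  proof -
    have "(W2 (v n) (v (Suc n)))\<^sup>2 * q < (17/64 * (1/16) ^ n) * q"
      using small[of n "Suc n"] by (simp add: \<delta>_def algebra_simps)
    also have "\<dots> \<le> (1/16) ^ n * q" using q by (intro mult_right_mono) auto
    finally have "(W2 (v n) (v (Suc n)))\<^sup>2 < (1/16) ^ n" using q by simp
    then show ?thesis
      unfolding W2sq_eq_W2[OF P2_W2sq_finite[OF v v]] by (simp add: ennreal_less_iff)
  qed
  then obtain Y where Y: "prob_borel Y" "\<And>n. W2sq (v n) Y \<le> ennreal (24 * (1/4) ^ n)"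
    by (rule W2sq_complete) blast
  have YP2: "Y \<in> P2 \<omega>0"
    by (rule P2_I[OF v[of 0] _ Y(1)]) (rule le_less_trans[OF Y(2)], simp)
  have vY: "(\<lambda>n. W2 (v n) Y) \<longlonglongrightarrow> 0"
  proof (rule tendsto_sandwich[of "\<lambda>_. 0" _ _ "\<lambda>n. sqrt (24 * (1/4) ^ n)"])
    have "W2 (v n) Y \<le> sqrt (24 * (1/4) ^ n)" for n
      using Y(2)[of n] unfolding W2sq_eq_W2[OF P2_W2sq_finite[OF v YP2]]
      by (intro real_le_rsqrt) (subst (asm) ennreal_le_iff, auto)
    then show "\<forall>\<^sub>F n in sequentially. W2 (v n) Y \<le> sqrt (24 * (1/4) ^ n)" by simp
    have "(\<lambda>n. sqrt (24 * (1/4 :: real) ^ n)) \<longlonglongrightarrow> sqrt (24 * 0)"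
      by (intro tendsto_intros LIMSEQ_power_zero) simp
    then show "(\<lambda>n. sqrt (24 * (1/4 :: real) ^ n)) \<longlonglongrightarrow> 0" by simp
  qed auto
  have yv: "(\<lambda>n. W2 y (v n)) \<longlonglongrightarrow> W2 y Y"
  proof (rule Lim_transform_bound[OF _ vY, THEN LIM_zero_cancel])
    have "norm (W2 y (v n) - W2 y Y) \<le> norm (W2 (v n) Y)" for n
      using P2_triangle[OF y v YP2, of n] P2_triangle[OF y YP2 v, of n] W2_commute[of Y "v n"]
      by (simp add: abs_le_iff)
    then show "\<forall>\<^sub>F n in sequentially. norm (W2 y (v n) - W2 y Y) \<le> norm (W2 (v n) Y)" by simp
  qed
  have \<delta>0: "\<delta> \<longlonglongrightarrow> 0"
  proof -
    have "(\<lambda>n. q / 8 * (1/16) ^ n) \<longlonglongrightarrow> q / 8 * 0"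
      by (intro tendsto_intros LIMSEQ_power_zero) simp
    then show ?thesis by (simp add: \<delta>_def[abs_def])
  qed
  let ?b = "\<lambda>n. ri + \<delta> n - (W2 y (v n))\<^sup>2 / (2 * h)"
  have "?b \<longlonglongrightarrow> ri + 0 - (W2 y Y)\<^sup>2 / (2 * h)"
    using h by (intro tendsto_intros \<delta>0 yv) auto
  then have lim_b: "(\<lambda>n. ereal (?b n)) \<longlonglongrightarrow> ereal (ri - (W2 y Y)\<^sup>2 / (2 * h))" by simp
  have "E Y \<le> liminf (\<lambda>n. E (v n))"
    using lsc v YP2 vY unfolding lsc_E_def by blast
  also have "\<dots> \<le> liminf (\<lambda>n. ereal (?b n))"
  proof (rule Liminf_mono, rule always_eventually, rule allI)
    show "E (v n) \<le> ereal (?b n)" for n using \<Phi>v[of n] by (simp add: Ev)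
  qed
  also have "\<dots> = ereal (ri - (W2 y Y)\<^sup>2 / (2 * h))"
    using lim_b by (intro lim_imp_Liminf) auto
  finally have "\<Phi> Y \<le> ereal ri"
    unfolding \<Phi>_def by (cases "E Y") auto
  then have "\<Phi> Y \<le> \<Phi> \<rho>" if "\<rho> \<in> P2 \<omega>0" for \<rho>
    using i_le[OF that] by (rule order_trans)
  then show ?thesis
    using YP2 by (auto simp: is_prox_def \<Phi>_def intro!: exI[of _ Y])
qed

section \<open>The slope bound and the estimate for single proximal steps\<close>

lemma prox_is_prox:
  assumes "slope_bound y s" "0 < h" "k * h < 1"
  shows "is_prox \<omega>0 E h y (prox \<omega>0 E h y)"
  using someI_ex[OF exists_prox[OF assms]] unfolding prox_def is_prox_def .

lemma is_prox_energy_finite: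
  assumes "slope_bound y s" "is_prox \<omega>0 E h y Y"
  obtains e where "E Y = ereal e"
proof -
  from assms(1) obtain e where y: "y \<in> P2 \<omega>0" and e: "E y = ereal e"
    unfolding slope_bound_def by blast
  have "ereal ((W2 y Y)\<^sup>2 / (2 * h)) + E Y \<le> ereal ((W2 y y)\<^sup>2 / (2 * h)) + E y"
    using assms(2) y by (simp add: is_prox_def)
  then show ?thesis
    using that energy assms(2) by (cases "E Y") (auto simp: e is_prox_def energy_on_def)
qed

text \<open>The variational inequality tested at \<open>y\<close>, with the slope bound there,
  limits the step length \<open>w\<close> to \<open>h * s / (1 - k * h)\<close>. Tested at
  \<open>v\<close> it makes \<open>w / h\<close> a slope bound at the new point.\<close>

lemma slope_bound_prox:
  assumes sb: "slope_bound y s" and h: "0 < h" "k * h < 1"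
  shows "slope_bound (prox \<omega>0 E h y) (s * inverse (1 - k * h))"
proof -
  let ?Y = "prox \<omega>0 E h y" and ?K = k
  from sb obtain e where y: "y \<in> P2 \<omega>0" and s: "0 \<le> s" and e: "E y = ereal e"
    and lower: "\<And>v e1. v \<in> P2 \<omega>0 \<Longrightarrow> E v = ereal e1 \<Longrightarrow> e \<le> e1 + s * W2 y v + k / 2 * (W2 y v)\<^sup>2"
    unfolding slope_bound_def by blast
  have prox: "is_prox \<omega>0 E h y ?Y" by (rule prox_is_prox[OF sb h])
  then have Y: "?Y \<in> P2 \<omega>0" by (simp add: is_prox_def)
  obtain eY where eY: "E ?Y = ereal eY" using is_prox_energy_finite[OF sb prox] .
  define w where "w = W2 y ?Y"
  have w: "0 \<le> w" by (simp add: w_def)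
  have kh: "0 < 1 - ?K * h" using h by simp
  have "w \<le> h * (s * inverse (1 - ?K * h))"
  proof (cases "w = 0")
    case False
    have "(1 - ?K * h) * w\<^sup>2 + w\<^sup>2 + 2 * h * eY \<le> 2 * h * e"
      using prox_evi[OF y y prox eY e h] P2_W2_refl[OF y] W2_commute[of ?Y y] by (simp add: w_def)
    moreover have "2 * h * e \<le> 2 * h * (eY + s * w + ?K / 2 * w\<^sup>2)"
      using lower[OF Y eY] h by (intro mult_left_mono) (auto simp: w_def)
    ultimately have "w * ((1 - ?K * h) * w) \<le> w * (h * s)"
      by (simp add: field_simps power2_eq_square)
    then have "(1 - ?K * h) * w \<le> h * s" using False w by simp
    then show ?thesis using kh by (simp add: field_simps)
  qed (use h s kh in simp)
  then have wh: "w / h \<le> s * inverse (1 - ?K * h)" using h by (simp add: field_simps)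
  have "eY \<le> e1 + s * inverse (1 - ?K * h) * W2 ?Y v + ?K / 2 * (W2 ?Y v)\<^sup>2"
    if v: "v \<in> P2 \<omega>0" and e1: "E v = ereal e1" for v e1
  proof -
    let ?d = "W2 ?Y v"
    have "(1 - ?K * h) * ?d\<^sup>2 + w\<^sup>2 + 2 * h * eY \<le> (W2 y v)\<^sup>2 + 2 * h * e1"
      unfolding w_def by (rule prox_evi[OF y v prox eY e1 h])
    \<comment> \<open>Expanding the square cancels \<open>w\<^sup>2\<close> and leaves the cross
      term \<open>2 * w * ?d\<close>, the source of the slope \<open>w / h\<close>.\<close>
    also have "(W2 y v)\<^sup>2 \<le> (w + ?d)\<^sup>2"
      unfolding w_def by (intro power_mono P2_triangle[OF y Y v]) auto
    finally have "eY \<le> e1 + w / h * ?d + ?K / 2 * ?d\<^sup>2"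
      using h(1) by (simp add: field_simps power2_eq_square)
    also have "w / h * ?d \<le> s * inverse (1 - ?K * h) * ?d" by (intro mult_right_mono wh) auto
    finally show ?thesis by simp
  qed
  moreover have "0 \<le> s * inverse (1 - ?K * h)" using s kh by simp
  ultimately show ?thesis using Y eY by (auto simp: slope_bound_def)
qed

text \<open>One step of the claim for general \<open>x\<close> and \<open>y\<close>. The bound at
  \<open>x\<close> guarantees that its proximal point is a minimizer; the bound at \<open>y\<close>
  also enters the estimate.\<close>

lemma prox_asymmetric_estimate:
  assumes x: "slope_bound x t" and y: "slope_bound y s" and h: "0 < h" "h \<le> \<tau>" and \<tau>: "k * \<tau> < 1"
  shows "(1 - k * h)\<^sup>2 * (W2 (prox \<omega>0 E \<tau> x) (prox \<omega>0 E h y))\<^sup>2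
    \<le> h / \<tau> * inverse (1 - k * \<tau>) * (W2 x y)\<^sup>2 + (\<tau> - h) / \<tau> * (W2 y (prox \<omega>0 E \<tau> x))\<^sup>2
      + h\<^sup>2 * s\<^sup>2 / (1 - k * h)"
proof -
  let ?X = "prox \<omega>0 E \<tau> x" and ?Y = "prox \<omega>0 E h y"
  have "k * h \<le> k * \<tau>" using h by (intro mult_left_mono) auto
  then have kh: "k * h < 1" using \<tau> by linarith
  have \<tau>0: "0 < \<tau>" using h by simp
  have X: "is_prox \<omega>0 E \<tau> x ?X" by (rule prox_is_prox[OF x \<tau>0 \<tau>])
  have Y: "is_prox \<omega>0 E h y ?Y" by (rule prox_is_prox[OF y h(1) kh])
  have P2: "x \<in> P2 \<omega>0" "y \<in> P2 \<omega>0" "?X \<in> P2 \<omega>0" "?Y \<in> P2 \<omega>0"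
    using x y X Y by (auto simp: slope_bound_def is_prox_def)
  obtain eX where eX: "E ?X = ereal eX" using is_prox_energy_finite[OF x X] .
  obtain eY where eY: "E ?Y = ereal eY" using is_prox_energy_finite[OF y Y] .
  from y obtain ey where ey: "E y = ereal ey"
    and lower: "\<And>v e1. v \<in> P2 \<omega>0 \<Longrightarrow> E v = ereal e1 \<Longrightarrow> ey \<le> e1 + s * W2 y v + k / 2 * (W2 y v)\<^sup>2"
    unfolding slope_bound_def by blast
  show ?thesis
  proof (rule asymmetric_estimate[where ey=ey and eX=eX and eY=eY and w="W2 y ?Y" and b="W2 x ?X"])
    show "(1 - k * h) * (W2 ?X ?Y)\<^sup>2 + (W2 y ?Y)\<^sup>2 + 2 * h * eY \<le> (W2 y ?X)\<^sup>2 + 2 * h * eX"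
      using prox_evi[OF P2(2,3) Y eY eX h(1) kh] by (simp only: W2_commute[of ?Y ?X])
    show "(1 - k * \<tau>) * (W2 y ?X)\<^sup>2 + (W2 x ?X)\<^sup>2 + 2 * \<tau> * eX \<le> (W2 x y)\<^sup>2 + 2 * \<tau> * ey"
      using prox_evi[OF P2(1,2) X eX ey \<tau>0 \<tau>] by (simp only: W2_commute[of ?X y])
    show "W2 y ?X \<le> W2 x y + W2 x ?X"
      using P2_triangle[OF P2(2,1,3)] by (simp only: W2_commute[of y x])
  qed (use lower[OF P2(3) eX] lower[OF P2(4) eY] h \<tau> in auto)
qed

lemma slope_bound_prox_iter:
  assumes "slope_bound \<mu> s" "\<And>i. i \<ge> 1 \<Longrightarrow> 0 < h i \<and> k * h i < 1"
  shows "slope_bound (prox_iter \<omega>0 E h \<mu> m) (s * (\<Prod>i=1..m. inverse (1 - k * h i)))"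
proof (induction m)
  case (Suc m)
  from slope_bound_prox[OF this, of "h (Suc m)"] assms(2)[of "Suc m"] show ?case
    by (simp add: mult.assoc)
qed (use assms in simp)

text \<open>Some bound at each iterate suffices to make the next proximal step a true minimizer, so
  its size is not tracked.\<close>

lemma slope_bound_prox_funpow:
  assumes "slope_bound \<mu> s" "0 < \<tau>" "k * \<tau> < 1"
  shows "\<exists>t. slope_bound ((prox \<omega>0 E \<tau> ^^ n) \<mu>) t"
  using assms by (induction n) (auto intro: slope_bound_prox)

end

section \<open>The estimate for iterated proximal steps\<close>

theorem theoremA1:
  fixes \<omega>0 :: "'a::euclidean_space measure"
    and E :: "'a measure \<Rightarrow> ereal"
    and lam \<tau> :: real and h :: "nat \<Rightarrow> real" and \<mu> :: "'a measure"
    and n m :: nat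
  assumes "energy_on \<omega>0 E" and "proper_E \<omega>0 E" and "coercive_E \<omega>0 E"
    and "lsc_E \<omega>0 E" and "gg_convex \<omega>0 E lam"
    and "\<mu> \<in> P2 \<omega>0" and "E \<mu> < \<infinity>" and "slope \<omega>0 E \<mu> < \<infinity>"
    and "\<And>i. i \<ge> 1 \<Longrightarrow> 0 < h i \<and> h i \<le> \<tau>"
    and "max 0 (-lam) = 0 \<or> \<tau> < 1 / max 0 (-lam)"
    and "n \<ge> 1" and "m \<ge> 1"
  shows "(1 - max 0 (-lam) * h m)\<^sup>2 * (W2 ((prox \<omega>0 E \<tau> ^^ n) \<mu>) (prox_iter \<omega>0 E h \<mu> m))\<^sup>2
    \<le> h m / \<tau> * inverse (1 - max 0 (-lam) * \<tau>)
        * (W2 ((prox \<omega>0 E \<tau> ^^ (n - 1)) \<mu>) (prox_iter \<omega>0 E h \<mu> (m - 1)))\<^sup>2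
      + (\<tau> - h m) / \<tau> * (W2 (prox_iter \<omega>0 E h \<mu> (m - 1)) ((prox \<omega>0 E \<tau> ^^ n) \<mu>))\<^sup>2
      + 2 * (h m)\<^sup>2 * (\<Prod>k=1..m. inverse (1 - max 0 (-lam) * h k))\<^sup>2
          * (real_of_ereal (slope \<omega>0 E \<mu>))\<^sup>2"
proof -
  interpret gg_convex_energy \<omega>0 E lam
    using assms by unfold_locales
  obtain n' where n: "n = Suc n'" using \<open>n \<ge> 1\<close> by (cases n) auto
  obtain m' where m: "m = Suc m'" using \<open>m \<ge> 1\<close> by (cases m) auto
  have k\<tau>: "k * \<tau> < 1"
  proof (cases "k = 0")
    case False
    then have "0 < k" by simp
    then show ?thesis using assms(10) False by (simp add: field_simps)
  qed simp
  have kh: "0 < h i \<and> k * h i < 1" if "i \<ge> 1" for i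
    using assms(9)[OF that] k\<tau> mult_left_mono[of "h i" \<tau> k] by auto
  have \<tau>: "0 < \<tau>" using assms(9)[of 1] by auto
  define s where "s = \<bar>real_of_ereal (slope \<omega>0 E \<mu>)\<bar>"
  have s: "slope_bound \<mu> s"
    unfolding s_def using assms by (intro slope_bound_slope)
  define P where "P j = (\<Prod>i=1..j. inverse (1 - k * h i))" for j
  have y: "slope_bound (prox_iter \<omega>0 E h \<mu> m') (s * P m')"
    unfolding P_def using s kh by (rule slope_bound_prox_iter)
  obtain t where x: "slope_bound ((prox \<omega>0 E \<tau> ^^ n') \<mu>) t"
    using slope_bound_prox_funpow[OF s \<tau> k\<tau>] by blast
  have hm: "0 < h m" "h m \<le> \<tau>" using assms(9)[OF \<open>m \<ge> 1\<close>] by auto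
  have q: "0 < 1 - k * h m" "1 - k * h m \<le> 1" using kh[OF \<open>m \<ge> 1\<close>] by auto
  \<comment> \<open>The slope bound at the iterate with index \<open>m - 1\<close> carries
    \<open>P m'\<close>. Since \<open>1 - k * h m\<close> lies in (0, 1], squaring the denominator
    enlarges the term and turns \<open>P m'\<close> into \<open>P m\<close>.\<close>
  have "(h m)\<^sup>2 * (s * P m')\<^sup>2 / (1 - k * h m) \<le> 2 * (h m)\<^sup>2 * (P m)\<^sup>2 * s\<^sup>2"
  proof -
    let ?c = "(h m)\<^sup>2 * (s * P m')\<^sup>2"
    have "?c / (1 - k * h m) \<le> ?c / (1 - k * h m)\<^sup>2"
      using q by (intro divide_left_mono) (auto simp: power2_eq_square mult_left_le)
    also have "\<dots> = (h m)\<^sup>2 * (P m)\<^sup>2 * s\<^sup>2"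
      unfolding m P_def by (simp add: power_mult_distrib power_inverse divide_inverse)
    also have "\<dots> \<le> 2 * (h m)\<^sup>2 * (P m)\<^sup>2 * s\<^sup>2"
      by simp
    finally show ?thesis .
  qed
  moreover have "s\<^sup>2 = (real_of_ereal (slope \<omega>0 E \<mu>))\<^sup>2"
    unfolding s_def by (rule power2_abs)
  ultimately show ?thesis
    using prox_asymmetric_estimate[OF x y hm k\<tau>] unfolding P_def by (simp add: n m)
qed

end
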